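(* Let $k\in L^{-1}\mathbb{Z}\setminus\{0\}$ be fixed and let $\rho_0\in C^1([-1,1])$ satisfy $\rho_0(\pm1)=\rho_\pm\in(0,\infty)$ and $\rho_0'>0$ everywhere on $[-1,1]$. For all $\mu>\mu_c(k,\Xi)$ there exists an infinite sequence $(\lambda_n,\phi_n)_{n\ge1}$, with $\lambda_n>0$ decreasing towards $0$ as $n\to\infty$ and $\phi_n\in H^4((-1,1))$ nontrivial, such that for every $n$, $(\lambda,\phi)=(\lambda_n,\phi_n)$ satisfies $$-\lambda^2\big(\rho_0k^2\phi-(\rho_0\phi')'\big)=\lambda\mu\big(\phi^{(4)}-2k^2\phi''+k^4\phi\big)-gk^2\rho_0'\phi\quad\text{on }(-1,1)$$ together with the boundary conditions $\phi(-1)=\phi(1)=0$, $\mu\phi''(1)=\xi_+\phi'(1)$, $\mu\phi''(-1)=-\xi_-\phi'(-1)$.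
   Context: Constants: $L>0$, $g>0$, $\mu>0$ (viscosity), $\xi_+,\xi_-\ge0$ (Navier-slip coefficients), $\Xi=(\xi_-,\xi_+)$. All functions are real-valued. The threshold is $$\mu_c(k,\Xi)=\max_{\phi\in\tilde H^2((-1,1))\setminus\{0\}}\frac{\xi_-(\phi'(-1))^2+\xi_+(\phi'(1))^2}{\int_{-1}^1\big((\phi'')^2+2k^2(\phi')^2+k^4\phi^2\big)dx_2},$$ where $\tilde H^2((-1,1))=\{\phi\in H^2((-1,1)):\phi(\pm1)=0\}$. *)

theory Defs
  imports "HOL-Analysis.Analysis"
begin

definition test_function :: "real \<Rightarrow> real \<Rightarrow> (real \<Rightarrow> real) \<Rightarrow> bool" where
  "test_function a b \<psi> \<longleftrightarrow>
     (\<forall>n x. ((deriv ^^ n) \<psi>) field_differentiable (at x)) \<and>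
     compact (closure {x. \<psi> x \<noteq> 0}) \<and> closure {x. \<psi> x \<noteq> 0} \<subseteq> {a<..<b}"

definition locally_integrable :: "real \<Rightarrow> real \<Rightarrow> (real \<Rightarrow> real) \<Rightarrow> bool" where
  "locally_integrable a b f \<longleftrightarrow>
     (\<forall>c d. a < c \<and> d < b \<longrightarrow> f absolutely_integrable_on {c..d})"

definition L2 :: "real \<Rightarrow> real \<Rightarrow> (real \<Rightarrow> real) set" where
  "L2 a b = {f. f \<in> borel_measurable (lebesgue_on {a<..<b}) \<and>
                integrable (lebesgue_on {a<..<b}) (\<lambda>x. (f x)\<^sup>2)}"

definition is_weak_deriv ::
  "real \<Rightarrow> real \<Rightarrow> nat \<Rightarrow> (real \<Rightarrow> real) \<Rightarrow> (real \<Rightarrow> real) \<Rightarrow> bool" where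
  "is_weak_deriv a b j f h \<longleftrightarrow>
     locally_integrable a b f \<and> locally_integrable a b h \<and>
     (\<forall>\<psi>. test_function a b \<psi> \<longrightarrow>
        (LINT x|lebesgue_on {a<..<b}. f x * (deriv ^^ j) \<psi> x) =
        (-1) ^ j * (LINT x|lebesgue_on {a<..<b}. h x * \<psi> x))"

text \<open>Elements of Sobolev spaces are represented by arbitrary functions on the real line,
  of which only the almost-everywhere class on (a,b) matters.\<close>

definition sobolev_H :: "nat \<Rightarrow> real \<Rightarrow> real \<Rightarrow> (real \<Rightarrow> real) set" where
  "sobolev_H m a b = {f \<in> L2 a b. \<forall>j\<le>m. \<exists>h\<in>L2 a b. is_weak_deriv a b j f h}"

text \<open>A representative of the j-th weak derivative (unique up to null sets; unspecified if
  there is none).\<close>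

definition weak_deriv :: "real \<Rightarrow> real \<Rightarrow> nat \<Rightarrow> (real \<Rightarrow> real) \<Rightarrow> real \<Rightarrow> real" where
  "weak_deriv a b j f = (SOME h. is_weak_deriv a b j f h)"

text \<open>The value at a point of [a,b], end points included, of the continuous representative
  of f; unspecified if f has none.\<close>

definition cont_value :: "real \<Rightarrow> real \<Rightarrow> (real \<Rightarrow> real) \<Rightarrow> real \<Rightarrow> real" where
  "cont_value a b f x =
     (THE y. \<exists>h. continuous_on {a..b} h \<and> (AE t in lebesgue_on {a<..<b}. f t = h t) \<and> h x = y)"

abbreviation wD :: "nat \<Rightarrow> (real \<Rightarrow> real) \<Rightarrow> real \<Rightarrow> real" where
  "wD \<equiv> weak_deriv (-1) 1"

abbreviation val :: "(real \<Rightarrow> real) \<Rightarrow> real \<Rightarrow> real" where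
  "val \<equiv> cont_value (-1) 1"

definition nontrivial :: "(real \<Rightarrow> real) \<Rightarrow> bool" where
  "nontrivial f \<longleftrightarrow> \<not> (AE x in lebesgue_on {-1<..<1}. f x = 0)"

definition H2_tilde :: "(real \<Rightarrow> real) set" where
  "H2_tilde = {\<phi> \<in> sobolev_H 2 (-1) 1. val \<phi> (-1) = 0 \<and> val \<phi> 1 = 0}"

definition slip_quotient :: "real \<Rightarrow> real \<Rightarrow> real \<Rightarrow> (real \<Rightarrow> real) \<Rightarrow> real" where
  "slip_quotient k \<xi>m \<xi>p \<phi> =
     (\<xi>m * (val (wD 1 \<phi>) (-1))\<^sup>2 + \<xi>p * (val (wD 1 \<phi>) 1)\<^sup>2) /
     (LINT x|lebesgue_on {-1<..<1}.
        (wD 2 \<phi> x)\<^sup>2 + 2 * k\<^sup>2 * (wD 1 \<phi> x)\<^sup>2 + k ^ 4 * (\<phi> x)\<^sup>2)"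

text \<open>A genuine maximum: the greatest element of the set of quotients, not merely its
  supremum.\<close>

definition mu_c :: "real \<Rightarrow> real \<Rightarrow> real \<Rightarrow> real" where
  "mu_c k \<xi>m \<xi>p =
     (GREATEST r. r \<in> slip_quotient k \<xi>m \<xi>p ` {\<phi> \<in> H2_tilde. nontrivial \<phi>})"

end

theory Submission
  imports Defs "HOL-Complex_Analysis.Great_Picard"
begin

text \<open>
  Divide the equation by \<open>\<lambda>\<close> and write \<open>u\<close> for \<open>\<phi>\<close>. In terms of \<open>h = u''\<close>, with the \<open>L\<^sup>2\<close> inner
  product, its weak form is the quadratic form of a symmetric operator \<open>\<mu> + K \<lambda>\<close> with \<open>K \<lambda>\<close> compact
  and continuous in \<open>\<lambda> > 0\<close>; every continuous \<open>h\<close> in the kernel is \<open>C\<^sup>2\<close> and gives a classical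
  solution, the slip conditions being the natural ones. For fixed \<open>\<lambda>\<close> the form has finite index,
  because its negative part is compact, while \<open>- (g k\<^sup>2 / \<lambda>) \<integral> \<rho>\<^sub>0' u\<^sup>2\<close> makes the index tend to infinity
  as \<open>\<lambda>\<close> tends to \<open>0\<close>. On an interval of \<open>\<lambda>\<close> without kernel the operators are uniformly bounded below,
  so the index is constant there. Hence the kernel is nontrivial for arbitrarily small \<open>\<lambda>\<close>.
  Classical derivatives are weak derivatives, and the latter are unique almost everywhere by the
  fundamental lemma of the calculus of variations.
\<close>

section \<open>Index of a family of compact perturbations\<close>

text \<open>The parameter \<kappa> (the \<lambda> of the equation) enters both linearly and through
  1/\<kappa>, so this is not the eigenvalue problem of one compact operator; counting negative
  directions only needs Lipschitz dependence on \<kappa>. With u'' as the unknown the fourth-order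
  term becomes \<mu> times the identity. The other terms are compact because u, u' and the end
  values of u' are integrals of u''; the slip conditions thus turn into terms of rank at most two
  instead of restricting the domain. Continuous functions with the L2 inner product form an
  incomplete space, so neither eigenvalues nor projections are used. Limits are instead produced
  inside the space: Arzela-Ascoli gives a continuous limit of the images under \<open>K\<close>, and
  vectors x with \<open>P \<kappa> x\<close> tending to 0 then converge, since x is recovered from
  \<open>P \<kappa> x\<close> and \<open>K \<kappa> x\<close> by a division by \<mu>. In return,
  kernel elements are continuous from the start.\<close>

text \<open>Negative definiteness on a space of dimension j. Linear independence of the \<phi> i is
  built in: a vanishing nontrivial combination would give the value 0, which is not
  negative.\<close>

definition neg_index :: "nat \<Rightarrow> ('a::real_inner \<Rightarrow> 'a) \<Rightarrow> bool" where
  "neg_index j T \<longleftrightarrow> (\<exists>\<phi>::nat \<Rightarrow> 'a. \<forall>a. (\<exists>i<j. a i \<noteq> 0) \<longrightarrow>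
     (\<Sum>i<j. a i *\<^sub>R \<phi> i) \<bullet> T (\<Sum>i<j. a i *\<^sub>R \<phi> i) < 0)"

definition pencil :: "(real \<Rightarrow> 'a \<Rightarrow> 'a::real_vector) \<Rightarrow> real \<Rightarrow> real \<Rightarrow> 'a \<Rightarrow> 'a" where
  "pencil K \<mu> \<kappa> x = \<mu> *\<^sub>R x + K \<kappa> x"

text \<open>In \<open>cpt\<close> the parameter varies along with the vector, as the contradiction
  in the uniform lower bound requires, and the limit must lie in the possibly incomplete space. One
  C serves for \<open>bound\<close> and \<open>lip\<close>.\<close>

locale compact_family =
  fixes K :: "real \<Rightarrow> 'a::real_inner \<Rightarrow> 'a" and \<mu> \<delta> \<epsilon> C :: real
  assumes \<mu>_pos: "\<mu> > 0" and C_pos: "C > 0"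
    and lin: "\<kappa> \<in> {\<delta>..\<epsilon>} \<Longrightarrow> linear (K \<kappa>)"
    and sym: "\<kappa> \<in> {\<delta>..\<epsilon>} \<Longrightarrow> K \<kappa> x \<bullet> y = x \<bullet> K \<kappa> y"
    and bound: "\<kappa> \<in> {\<delta>..\<epsilon>} \<Longrightarrow> norm (K \<kappa> x) \<le> C * norm x"
    and lip: "\<kappa> \<in> {\<delta>..\<epsilon>} \<Longrightarrow> \<kappa>' \<in> {\<delta>..\<epsilon>} \<Longrightarrow>
      norm (K \<kappa> x - K \<kappa>' x) \<le> C * \<bar>\<kappa> - \<kappa>'\<bar> * norm x"
    and cpt: "(\<And>n. l n \<in> {\<delta>..\<epsilon>}) \<Longrightarrow> (\<And>n. norm (X n) \<le> 1) \<Longrightarrow>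
      \<exists>r y. strict_mono (r :: nat \<Rightarrow> nat) \<and> (\<lambda>n. K (l (r n)) (X (r n))) \<longlonglongrightarrow> y"
begin

abbreviation P :: "real \<Rightarrow> 'a \<Rightarrow> 'a" where
  "P \<equiv> pencil K \<mu>"

lemma linear_P: "\<kappa> \<in> {\<delta>..\<epsilon>} \<Longrightarrow> linear (P \<kappa>)"
  unfolding pencil_def by (intro linear_compose_add linear_compose_scale_right linear_id[unfolded id_def] lin)

lemma P_sym: "\<kappa> \<in> {\<delta>..\<epsilon>} \<Longrightarrow> P \<kappa> x \<bullet> y = x \<bullet> P \<kappa> y"
  by (simp add: pencil_def inner_simps sym)

lemma P_bound: "\<kappa> \<in> {\<delta>..\<epsilon>} \<Longrightarrow> norm (P \<kappa> x) \<le> (\<mu> + C) * norm x"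
  unfolding pencil_def using bound[of \<kappa> x] \<mu>_pos
  by (intro order_trans[OF norm_triangle_ineq]) (simp add: algebra_simps)

lemma P_lip: "\<kappa> \<in> {\<delta>..\<epsilon>} \<Longrightarrow> \<kappa>' \<in> {\<delta>..\<epsilon>} \<Longrightarrow>
    norm (P \<kappa> x - P \<kappa>' x) \<le> C * \<bar>\<kappa> - \<kappa>'\<bar> * norm x"
  using lip[of \<kappa> \<kappa>' x] by (simp add: pencil_def)

text \<open>Compactness: unit vectors on which \<open>P\<close> tends to 0 have a convergent
  subsequence, because their images under \<open>K\<close> have one, and continuity in \<kappa>
  makes the limit a unit vector in a kernel.\<close>

lemma uniform_lower_bound:
  assumes nk: "\<forall>\<kappa>\<in>{\<delta>..\<epsilon>}. \<forall>x. P \<kappa> x = 0 \<longrightarrow> x = 0"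
  shows "\<exists>s>0. \<forall>\<kappa>\<in>{\<delta>..\<epsilon>}. \<forall>x. norm (P \<kappa> x) \<ge> s * norm x"
proof (rule ccontr)
    assume neg: "\<not> ?thesis"
    have "\<exists>\<kappa> x. \<kappa> \<in> {\<delta>..\<epsilon>} \<and> norm x = 1 \<and> norm (P \<kappa> x) < inverse (Suc n)" for n
    proof -
      obtain \<kappa> x where *: "\<kappa> \<in> {\<delta>..\<epsilon>}" "norm (P \<kappa> x) < inverse (Suc n) * norm x"
      proof -
        have "inverse (real (Suc n)) > 0" by simp
        with neg have "\<not> (\<forall>\<kappa>\<in>{\<delta>..\<epsilon>}. \<forall>x. norm (P \<kappa> x) \<ge> inverse (Suc n) * norm x)"
          by blast
        then show ?thesis using that by (auto simp: not_le)
      qed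
      then have "x \<noteq> 0"
        using linear_0[OF linear_P] by fastforce
      with * show ?thesis
        by (intro exI[of _ \<kappa>] exI[of _ "x /\<^sub>R norm x"])
          (simp add: linear_scale[OF linear_P] field_simps)
    qed
    then obtain l x where l: "\<And>n. l n \<in> {\<delta>..\<epsilon>}" and x: "\<And>n. norm (x n) = 1"
      and Px: "\<And>n. norm (P (l n) (x n)) < inverse (Suc n)"
      by metis
    obtain r1 l0 where l0: "l0 \<in> {\<delta>..\<epsilon>}" and r1: "strict_mono (r1 :: nat \<Rightarrow> nat)" and lr1: "(l \<circ> r1) \<longlonglongrightarrow> l0"
      using compact_Icc[unfolded compact_def, rule_format, of l] l by metis
    obtain r2 y where r2: "strict_mono (r2 :: nat \<Rightarrow> nat)"
      and Ky: "(\<lambda>n. K (l (r1 (r2 n))) (x (r1 (r2 n)))) \<longlonglongrightarrow> y"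
      using cpt[of "l \<circ> r1" "x \<circ> r1"] l x by (auto simp: less_imp_le)
    define r where "r = r1 \<circ> r2"
    have r: "strict_mono r" using r1 r2 by (simp add: r_def strict_mono_o)
    have lr: "(\<lambda>n. l (r n)) \<longlonglongrightarrow> l0"
      using LIMSEQ_subseq_LIMSEQ[OF lr1 r2] by (simp add: r_def o_def)
    have Kr: "(\<lambda>n. K (l (r n)) (x (r n))) \<longlonglongrightarrow> y" using Ky by (simp add: r_def)
    have "(\<lambda>n. P (l n) (x n)) \<longlonglongrightarrow> 0"
      by (rule LIMSEQ_norm_0) (use Px in \<open>simp add: inverse_eq_divide\<close>)
    then have Pr: "(\<lambda>n. P (l (r n)) (x (r n))) \<longlonglongrightarrow> 0"
      using LIMSEQ_subseq_LIMSEQ[OF _ r] by (auto simp: o_def)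
    \<comment> \<open>From x = (P x - K x) / \<mu>, where P x tends to 0 and K x to y.\<close>
    define x0 where "x0 = (0 - y) /\<^sub>R \<mu>"
    have "(\<lambda>n. (P (l (r n)) (x (r n)) - K (l (r n)) (x (r n))) /\<^sub>R \<mu>) \<longlonglongrightarrow> x0"
      unfolding x0_def by (intro tendsto_intros Pr Kr)
    then have xr: "(\<lambda>n. x (r n)) \<longlonglongrightarrow> x0"
      using \<mu>_pos by (simp add: pencil_def)
    have "norm x0 = 1"
      using tendsto_norm[OF xr] by (simp add: x LIMSEQ_const_iff)
    have "(\<lambda>n. P l0 x0 - P (l (r n)) (x (r n))) \<longlonglongrightarrow> 0"
    proof (rule Lim_null_comparison[OF always_eventually])
      show "\<forall>n. norm (P l0 x0 - P (l (r n)) (x (r n)))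
          \<le> (\<mu> + C) * norm (x0 - x (r n)) + C * \<bar>l0 - l (r n)\<bar>"
      proof
        fix n
        \<comment> \<open>The error is split into a change of the vector and a change of the
          parameter.\<close>
        have "P l0 x0 - P (l (r n)) (x (r n))
            = P l0 (x0 - x (r n)) + (P l0 (x (r n)) - P (l (r n)) (x (r n)))"
          by (simp add: linear_diff[OF linear_P[OF l0]])
        then show "norm (P l0 x0 - P (l (r n)) (x (r n)))
          \<le> (\<mu> + C) * norm (x0 - x (r n)) + C * \<bar>l0 - l (r n)\<bar>"
          using P_bound[OF l0, of "x0 - x (r n)"] P_lip[OF l0 l, of "x (r n)" "r n"] x
          by (metis (no_types, lifting) add_mono mult.right_neutral norm_triangle_mono)
      qed
      have "(\<lambda>n. (\<mu> + C) * norm (x0 - x (r n)) + C * \<bar>l0 - l (r n)\<bar>)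
          \<longlonglongrightarrow> (\<mu> + C) * norm (x0 - x0) + C * \<bar>l0 - l0\<bar>"
        by (intro tendsto_intros xr lr)
      then show "(\<lambda>n. (\<mu> + C) * norm (x0 - x (r n)) + C * \<bar>l0 - l (r n)\<bar>) \<longlonglongrightarrow> 0"
        by simp
    qed
    from tendsto_add[OF this Pr] have "P l0 x0 = 0"
      by (simp add: LIMSEQ_const_iff)
    with nk l0 have "x0 = 0" by blast
    with \<open>norm x0 = 1\<close> show False by simp
qed

text \<open>A gradient step with step size \<open>t\<close> turns a subspace on which the form of \<open>P \<kappa>\<close> is
  negative into one on which it is negative by a margin that depends only on the lower bound
  \<open>s\<close>; the margin absorbs a change of \<open>\<kappa>\<close> of a fixed size.\<close>

lemma neg_index_step:
  assumes nk: "\<forall>\<kappa>\<in>{\<delta>..\<epsilon>}. \<forall>x. P \<kappa> x = 0 \<longrightarrow> x = 0"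
  shows "\<exists>\<eta>>0. \<forall>\<kappa>\<in>{\<delta>..\<epsilon>}. \<forall>\<kappa>'\<in>{\<delta>..\<epsilon>}. \<forall>j. \<bar>\<kappa> - \<kappa>'\<bar> \<le> \<eta> \<longrightarrow>
    neg_index j (P \<kappa>) \<longrightarrow> neg_index j (P \<kappa>')"
proof -
  obtain s where s: "s > 0" "\<And>\<kappa> x. \<kappa> \<in> {\<delta>..\<epsilon>} \<Longrightarrow> norm (P \<kappa> x) \<ge> s * norm x"
    using uniform_lower_bound[OF nk] by blast
  define M where "M = \<mu> + C"
  have M: "M > 0" using \<mu>_pos C_pos by (simp add: M_def)
  \<comment> \<open>The minimiser of - 2 t s^2 + t^2 M^3; the minimum is - t s^2, the margin gained
    below.\<close>
  define t where "t = s\<^sup>2 / M^3"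
  have t: "t > 0" using s M by (simp add: t_def)
  \<comment> \<open>Solves C \<eta> (1 + t M)^2 = t s^2 / 2: a change of \<kappa> by \<eta> costs
    half of the margin, since norm z is at most (1 + t M) norm x.\<close>
  define \<eta> where "\<eta> = t * s\<^sup>2 / (2 * C * (1 + t * M)\<^sup>2)"
  have \<eta>: "\<eta> > 0"
    unfolding \<eta>_def using s M t C_pos by (intro divide_pos_pos mult_pos_pos zero_less_power add_pos_pos) auto
  have "neg_index j (P \<kappa>')" if l: "\<kappa> \<in> {\<delta>..\<epsilon>}" "\<kappa>' \<in> {\<delta>..\<epsilon>}" "\<bar>\<kappa> - \<kappa>'\<bar> \<le> \<eta>" "neg_index j (P \<kappa>)" for \<kappa> \<kappa>' j
  proof -
    have key: "z \<bullet> P \<kappa>' z < 0" if neg: "x \<bullet> P \<kappa> x < 0" and z: "z = x - t *\<^sub>R P \<kappa> x" for x z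
    proof -
      have "x \<noteq> 0" using neg by auto
      define p where "p = P \<kappa> x"
      have plow: "s * norm x \<le> norm p" and pup: "norm p \<le> M * norm x"
        using s(2)[OF l(1)] P_bound[OF l(1)] by (auto simp: p_def M_def)
      have Pp: "norm (P \<kappa> p) \<le> M * norm p"
        using P_bound[OF l(1)] by (auto simp: M_def)
      \<comment> \<open>Symmetry turns the two cross terms into - 2 t (p \<bullet> p), which the
        lower bound s makes strictly negative.\<close>
      have "z \<bullet> P \<kappa> z = x \<bullet> p - 2 * t * (p \<bullet> p) + t\<^sup>2 * (p \<bullet> P \<kappa> p)"
        using P_sym[OF l(1), of x p]
        by (simp add: z p_def linear_diff[OF linear_P[OF l(1)]] linear_scale[OF linear_P[OF l(1)]]
            inner_simps algebra_simps power2_eq_square inner_commute)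
      moreover have "p \<bullet> P \<kappa> p \<le> M^3 * (norm x)\<^sup>2"
      proof -
        have "p \<bullet> P \<kappa> p \<le> norm p * norm (P \<kappa> p)" by (rule norm_cauchy_schwarz)
        also have "\<dots> \<le> (M * norm x) * (M * (M * norm x))"
          using pup Pp M by (intro mult_mono order_trans[OF Pp] mult_left_mono) auto
        finally show ?thesis by (simp add: power3_eq_cube power2_eq_square mult_ac)
      qed
      moreover have "s\<^sup>2 * (norm x)\<^sup>2 \<le> p \<bullet> p"
        using power_mono[OF plow, of 2] s by (simp add: power_mult_distrib power2_norm_eq_inner)
      moreover have "x \<bullet> p < 0" using neg by (simp add: p_def)
      moreover note mult_left_mono[OF _ less_imp_le, of "s\<^sup>2 * (norm x)\<^sup>2" "p \<bullet> p" "2 * t"]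
        mult_left_mono[OF _ zero_le_power2, of "p \<bullet> P \<kappa> p" "M^3 * (norm x)\<^sup>2" t]
      ultimately have "z \<bullet> P \<kappa> z < - (2 * t) * (s\<^sup>2 * (norm x)\<^sup>2) + t\<^sup>2 * (M^3 * (norm x)\<^sup>2)"
        using t by linarith
      also have "\<dots> = - t * s\<^sup>2 * (norm x)\<^sup>2"
        using M by (simp add: t_def power2_eq_square field_simps)
      finally have 1: "z \<bullet> P \<kappa> z < - t * s\<^sup>2 * (norm x)\<^sup>2" .
      have nz: "norm z \<le> (1 + t * M) * norm x"
      proof -
        have "norm z \<le> norm x + t * norm p"
          unfolding z p_def using norm_triangle_ineq4[of x "t *\<^sub>R P \<kappa> x"] t by simp
        also have "\<dots> \<le> norm x + t * (M * norm x)"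
          using pup t by simp
        finally show ?thesis by (simp add: algebra_simps)
      qed
      have "z \<bullet> P \<kappa>' z - z \<bullet> P \<kappa> z = z \<bullet> (P \<kappa>' z - P \<kappa> z)" by (simp add: inner_simps)
      also have "\<dots> \<le> norm z * norm (P \<kappa>' z - P \<kappa> z)" by (rule norm_cauchy_schwarz)
      also have "\<dots> \<le> norm z * (C * \<eta> * norm z)"
      proof (intro mult_left_mono norm_ge_zero order_trans[OF P_lip[OF l(2,1)]] mult_right_mono)
        show "\<bar>\<kappa>' - \<kappa>\<bar> \<le> \<eta>" using l(3) by linarith
      qed (use C_pos in auto)
      also have "\<dots> = C * \<eta> * (norm z)\<^sup>2" by (simp add: power2_eq_square)
      also have "\<dots> \<le> C * \<eta> * ((1 + t * M) * norm x)\<^sup>2"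
        using nz C_pos \<eta> by (intro mult_left_mono power_mono) auto
      also have "\<dots> = t * s\<^sup>2 / 2 * (norm x)\<^sup>2"
      proof -
        have "1 + t * M > 0" using t M by (simp add: add_pos_pos)
        then show ?thesis using C_pos by (simp add: \<eta>_def power_mult_distrib)
      qed
      finally have "z \<bullet> P \<kappa>' z < - t * s\<^sup>2 * (norm x)\<^sup>2 + t * s\<^sup>2 / 2 * (norm x)\<^sup>2"
        using 1 by linarith
      also have "\<dots> \<le> 0" using t by simp
      finally show ?thesis .
    qed
    obtain \<phi> where \<phi>: "\<And>a. \<exists>i<j. a i \<noteq> 0 \<Longrightarrow>
        (\<Sum>i<j. a i *\<^sub>R \<phi> i) \<bullet> P \<kappa> (\<Sum>i<j. a i *\<^sub>R \<phi> i) < 0"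
      using l(4) unfolding neg_index_def by blast
    \<comment> \<open>The gradient step is linear, so moving each spanning vector moves every
      combination accordingly.\<close>
    have comb: "(\<Sum>i<j. a i *\<^sub>R (\<phi> i - t *\<^sub>R P \<kappa> (\<phi> i)))
        = (\<Sum>i<j. a i *\<^sub>R \<phi> i) - t *\<^sub>R P \<kappa> (\<Sum>i<j. a i *\<^sub>R \<phi> i)" for a
      by (simp add: linear_sum[OF linear_P[OF l(1)]] linear_scale[OF linear_P[OF l(1)]]
          scaleR_right_diff_distrib sum_subtractf scaleR_sum_right mult.commute)
    show ?thesis
      unfolding neg_index_def
    proof (intro exI allI impI)
      fix a assume "\<exists>i<j. (a i :: real) \<noteq> 0"
      then show "(\<Sum>i<j. a i *\<^sub>R (\<phi> i - t *\<^sub>R P \<kappa> (\<phi> i)))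
          \<bullet> P \<kappa>' (\<Sum>i<j. a i *\<^sub>R (\<phi> i - t *\<^sub>R P \<kappa> (\<phi> i))) < 0"
        by (rule key[OF \<phi> comb])
    qed
  qed
  with \<eta> show ?thesis by blast
qed

text \<open>The step length \<eta> is the same for all \<kappa>, so finitely many steps cross the
  interval; \<open>min\<close> stops the last one at \<epsilon>.\<close>

lemma neg_index_propagates:
  assumes nk: "\<forall>\<kappa>\<in>{\<delta>..\<epsilon>}. \<forall>x. P \<kappa> x = 0 \<longrightarrow> x = 0"
    and "\<delta> \<le> \<epsilon>" "neg_index j (P \<delta>)"
  shows "neg_index j (P \<epsilon>)"
proof -
  obtain \<eta> where \<eta>: "\<eta> > 0" and step: "\<And>\<kappa> \<kappa>' j. \<kappa> \<in> {\<delta>..\<epsilon>} \<Longrightarrow> \<kappa>' \<in> {\<delta>..\<epsilon>} \<Longrightarrow> \<bar>\<kappa> - \<kappa>'\<bar> \<le> \<eta> \<Longrightarrow>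
    neg_index j (P \<kappa>) \<Longrightarrow> neg_index j (P \<kappa>')"
    using neg_index_step[OF nk] by blast
  have "neg_index j (P (min \<epsilon> (\<delta> + n * \<eta>)))" for n :: nat
  proof (induction n)
    case (Suc n)
    show ?case
      by (rule step[OF _ _ _ Suc.IH])
        (use \<eta> \<open>\<delta> \<le> \<epsilon>\<close> in \<open>auto simp: min_def algebra_simps\<close>)
  qed (use assms in simp)
  moreover obtain n :: nat where "n * \<eta> \<ge> \<epsilon> - \<delta>"
    using reals_Archimedean3[OF \<eta>] less_imp_le by blast
  ultimately show ?thesis
    by (metis add.commute diff_le_eq min.absorb1)
qed

end

text \<open>Gaussian elimination, by induction on the number of equations. It serves to find, in a
  space of large dimension, a nonzero coefficient vector annihilated by prescribed
  functionals.\<close>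

lemma homogeneous_system_solution:
  fixes c :: "nat \<Rightarrow> 'i \<Rightarrow> real"
  assumes "finite J" "card J > n"
  shows "\<exists>a. (\<exists>i\<in>J. a i \<noteq> 0) \<and> (\<forall>l<n. (\<Sum>i\<in>J. a i * c l i) = 0)"
  using assms
proof (induction n arbitrary: J c)
  case 0
  then obtain i where "i \<in> J" by fastforce
  then show ?case by (intro exI[of _ "\<lambda>_. 1"]) auto
next
  case (Suc n)
  show ?case
  proof (cases "\<forall>i\<in>J. c n i = 0")
    case True
    from Suc obtain a where a: "\<exists>i\<in>J. a i \<noteq> 0" "\<forall>l<n. (\<Sum>i\<in>J. a i * c l i) = 0"
      by (meson Suc_lessD)
    moreover have "(\<Sum>i\<in>J. a i * c n i) = 0" using True by (intro sum.neutral) auto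
    ultimately show ?thesis by (intro exI[of _ a]) (auto simp: less_Suc_eq)
  next
    case False
    then obtain p where p: "p \<in> J" "c n p \<noteq> 0" by blast
    define J' where "J' = J - {p}"
    have J': "finite J'" "card J' > n" "p \<notin> J'" "J = insert p J'"
      using Suc.prems p by (auto simp: J'_def card_Diff_singleton)
    obtain a where a: "\<exists>i\<in>J'. a i \<noteq> 0"
      "\<forall>l<n. (\<Sum>i\<in>J'. a i * (c l i - c n i / c n p * c l p)) = 0"
      using Suc.IH[OF J'(1,2), of "\<lambda>l i. c l i - c n i / c n p * c l p"] by blast
    \<comment> \<open>The value that equation n forces on the pivot unknown p.\<close>
    define q where "q = - (\<Sum>i\<in>J'. a i * c n i / c n p)"
    define a' where "a' = a(p := q)"
    have eq: "(\<Sum>i\<in>J. a' i * c l i) = q * c l p + (\<Sum>i\<in>J'. a i * c l i)" for l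
    proof -
      have "(\<Sum>i\<in>J'. a' i * c l i) = (\<Sum>i\<in>J'. a i * c l i)"
        using J'(3) by (intro sum.cong) (auto simp: a'_def)
      then show ?thesis using J' by (simp add: a'_def)
    qed
    have "(\<Sum>i\<in>J. a' i * c l i) = (\<Sum>i\<in>J'. a i * (c l i - c n i / c n p * c l p))" for l
    proof -
      have "q * c l p = - (\<Sum>i\<in>J'. a i * (c n i / c n p * c l p))"
        by (simp add: q_def sum_distrib_right mult.assoc)
      then show ?thesis
        unfolding eq by (simp add: right_diff_distrib sum_subtractf)
    qed
    moreover have "(\<Sum>i\<in>J'. a i * (c n i - c n i / c n p * c n p)) = 0"
      using p by simp
    ultimately have "\<forall>l<Suc n. (\<Sum>i\<in>J. a' i * c l i) = 0"
      using a(2) by (auto simp: less_Suc_eq)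
    moreover have "\<exists>i\<in>J. a' i \<noteq> 0" using a(1) J' by (auto simp: a'_def)
    ultimately show ?thesis by blast
  qed
qed

section \<open>Continuous functions on an interval\<close>

lemma continuous_on_by_deriv:
  assumes "\<And>x. x \<in> {a..b} \<Longrightarrow> (f has_real_derivative f' x) (at x within {a..b})"
  shows "continuous_on {a..b} f"
  using assms by (meson DERIV_continuous continuous_on_eq_continuous_within)

lemma integral_by_parts_Icc:
  fixes f f' g g' :: "real \<Rightarrow> real"
  assumes "a \<le> b"
    and f: "\<And>x. x \<in> {a..b} \<Longrightarrow> (f has_real_derivative f' x) (at x within {a..b})"
    and g: "\<And>x. x \<in> {a..b} \<Longrightarrow> (g has_real_derivative g' x) (at x within {a..b})"
    and f': "continuous_on {a..b} f'" and g': "continuous_on {a..b} g'"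
  shows "integral {a..b} (\<lambda>x. f x * g' x) = f b * g b - f a * g a - integral {a..b} (\<lambda>x. f' x * g x)"
proof -
  note [continuous_intros] = continuous_on_by_deriv[OF f] continuous_on_by_deriv[OF g] f' g'
  have "((\<lambda>x. f' x * g x + f x * g' x) has_integral f b * g b - f a * g a) {a..b}"
    using \<open>a \<le> b\<close>
    by (intro fundamental_theorem_of_calculus)
      (auto simp flip: has_real_derivative_iff_has_vector_derivative
        intro!: derivative_eq_intros f g)
  then have "integral {a..b} (\<lambda>x. f' x * g x + f x * g' x) = f b * g b - f a * g a"
    by (rule integral_unique)
  moreover have "integral {a..b} (\<lambda>x. f' x * g x + f x * g' x)
      = integral {a..b} (\<lambda>x. f' x * g x) + integral {a..b} (\<lambda>x. f x * g' x)"
    by (intro integral_add integrable_continuous_real continuous_intros)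
  ultimately show ?thesis by simp
qed

text \<open>Cauchy-Schwarz against the constant 1, from the nonnegative integral of (f - m)^2 with m
  the mean; 2 is the length of the interval.\<close>

lemma integral_sq_le:
  fixes f :: "real \<Rightarrow> real"
  assumes "continuous_on {-1..1} f"
  shows "(integral {-1..1} f)\<^sup>2 \<le> 2 * integral {-1..1} (\<lambda>x. (f x)\<^sup>2)"
proof -
  define m where "m = integral {-1..1} f / 2"
  have "0 \<le> integral {-1..1} (\<lambda>x. (f x - m)\<^sup>2)"
    by (intro integral_nonneg integrable_continuous_real continuous_intros assms) auto
  also have "(\<lambda>x. (f x - m)\<^sup>2) = (\<lambda>x. ((f x)\<^sup>2 - 2 * m * f x) + m\<^sup>2)"
    by (simp add: power2_diff algebra_simps fun_eq_iff)
  also have "integral {-1..1} \<dots> = integral {-1..1} (\<lambda>x. (f x)\<^sup>2) - 2 * m * integral {-1..1} f + 2 * m\<^sup>2"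
    by (subst integral_add, (intro integrable_continuous_real continuous_intros assms)+,
        subst integral_diff, (intro integrable_continuous_real continuous_intros assms)+) simp
  finally show ?thesis by (simp add: m_def power2_eq_square field_simps)
qed

subsection \<open>The Dirichlet problem for the second derivative\<close>

definition primitive :: "(real \<Rightarrow> real) \<Rightarrow> real \<Rightarrow> real" where
  "primitive h x = integral {-1..x} h"

text \<open>Subtracting the mean makes the integral over [-1,1] vanish, which is the boundary
  condition at 1 for the solution u of u'' = h; this function is u'.\<close>

definition dirichlet_deriv :: "(real \<Rightarrow> real) \<Rightarrow> real \<Rightarrow> real" where
  "dirichlet_deriv h x = primitive h x - integral {-1..1} (primitive h) / 2"

definition dirichlet :: "(real \<Rightarrow> real) \<Rightarrow> real \<Rightarrow> real" where
  "dirichlet h x = primitive (dirichlet_deriv h) x"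

lemma primitive_deriv:
  "continuous_on {-1..1} h \<Longrightarrow> x \<in> {-1..1} \<Longrightarrow> (primitive h has_real_derivative h x) (at x within {-1..1})"
  unfolding primitive_def by (rule integral_has_real_derivative)

lemma primitive_cont [continuous_intros]: "continuous_on {-1..1} h \<Longrightarrow> continuous_on {-1..1} (primitive h)"
  by (rule continuous_on_by_deriv[OF primitive_deriv])

lemma dirichlet_deriv_deriv:
  "continuous_on {-1..1} h \<Longrightarrow> x \<in> {-1..1} \<Longrightarrow> (dirichlet_deriv h has_real_derivative h x) (at x within {-1..1})"
  unfolding dirichlet_deriv_def by (auto intro!: derivative_eq_intros primitive_deriv)

lemma dirichlet_deriv_cont [continuous_intros]: "continuous_on {-1..1} h \<Longrightarrow> continuous_on {-1..1} (dirichlet_deriv h)"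
  by (rule continuous_on_by_deriv[OF dirichlet_deriv_deriv])

lemma dirichlet_deriv:
  "continuous_on {-1..1} h \<Longrightarrow> x \<in> {-1..1} \<Longrightarrow> (dirichlet h has_real_derivative dirichlet_deriv h x) (at x within {-1..1})"
  unfolding dirichlet_def by (intro primitive_deriv dirichlet_deriv_cont)

lemma dirichlet_cont [continuous_intros]: "continuous_on {-1..1} h \<Longrightarrow> continuous_on {-1..1} (dirichlet h)"
  by (rule continuous_on_by_deriv[OF dirichlet_deriv])

lemma dirichlet_left [simp]: "dirichlet h (-1) = 0"
  by (simp add: dirichlet_def primitive_def)

lemma dirichlet_right [simp]:
  assumes "continuous_on {-1..1} h"
  shows "dirichlet h 1 = 0"
proof -
  have "integral {-1..1} (\<lambda>x. primitive h x - integral {-1..1} (primitive h) / 2) = 0"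
    by (subst integral_diff) (intro integrable_continuous_real continuous_intros assms | simp)+
  then show ?thesis by (simp add: dirichlet_def primitive_def[of "\<lambda>x. dirichlet_deriv h x"] dirichlet_deriv_def[abs_def] primitive_def[of "\<lambda>x. primitive h x - _"])
qed

lemma zero_deriv_const:
  assumes "\<And>x. x \<in> {-1..1} \<Longrightarrow> (f has_real_derivative 0) (at x within {-1..1})" "x \<in> {-1..1::real}"
  shows "f x = f (-1)"
  using has_field_derivative_zero_constant[of "{-1..1}" f] assms
  by (metis atLeastAtMost_iff convex_real_interval(5) neg_le_iff_le order_refl zero_le_one order_trans le_minus_one_simps(1))

text \<open>The derivatives differ by a constant m, so the functions differ by an affine function
  that vanishes at both ends.\<close>

lemma dirichlet_unique:
  assumes h: "continuous_on {-1..1} h"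
    and u: "\<And>x. x \<in> {-1..1} \<Longrightarrow> (u has_real_derivative u' x) (at x within {-1..1})"
    and u': "\<And>x. x \<in> {-1..1} \<Longrightarrow> (u' has_real_derivative h x) (at x within {-1..1})"
    and bc: "u (-1) = 0" "u 1 = 0" and x: "x \<in> {-1..1}"
  shows "dirichlet h x = u x" "dirichlet_deriv h x = u' x"
proof -
  define m where "m = dirichlet_deriv h (-1) - u' (-1)"
  have m: "dirichlet_deriv h x - u' x = m" if "x \<in> {-1..1}" for x
    unfolding m_def
    by (rule zero_deriv_const[OF _ that]) (auto intro!: derivative_eq_intros dirichlet_deriv_deriv[OF h] u')
  have "(\<lambda>x. dirichlet h x - u x - m * x) y = (\<lambda>x. dirichlet h x - u x - m * x) (-1)" if "y \<in> {-1..1}" for y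
  proof (rule zero_deriv_const[OF _ that])
    fix x :: real assume x: "x \<in> {-1..1}"
    have "((\<lambda>x. dirichlet h x - u x - m * x) has_real_derivative dirichlet_deriv h x - u' x - m * 1) (at x within {-1..1})"
      by (intro derivative_intros DERIV_cmult DERIV_ident dirichlet_deriv[OF h] u x)
    with m[OF x] show "((\<lambda>x. dirichlet h x - u x - m * x) has_real_derivative 0) (at x within {-1..1})"
      by simp
  qed
  then have *: "dirichlet h y - u y - m * y = m" if "y \<in> {-1..1}" for y
    using that bc by simp
  from *[of 1] have "m = 0" using h bc by simp
  with *[of x] m[of x] x show "dirichlet h x = u x" "dirichlet_deriv h x = u' x" by auto
qed

section \<open>Linearity of the solution operator\<close>

lemma primitive_add: "continuous_on {-1..1} f \<Longrightarrow> continuous_on {-1..1} g \<Longrightarrow> x \<in> {-1..1} \<Longrightarrow>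
    primitive (\<lambda>t. f t + g t) x = primitive f x + primitive g x"
  unfolding primitive_def
  by (intro integral_add integrable_continuous_real) (auto elim: continuous_on_subset)

lemma primitive_cmult: "primitive (\<lambda>t. c * f t) x = c * primitive f x"
  unfolding primitive_def by simp

lemma primitive_cong: "(\<And>t. t \<in> {-1..1} \<Longrightarrow> f t = g t) \<Longrightarrow> x \<in> {-1..1} \<Longrightarrow> primitive f x = primitive g x"
  unfolding primitive_def by (intro integral_cong) auto

lemma dirichlet_deriv_add: "continuous_on {-1..1} f \<Longrightarrow> continuous_on {-1..1} g \<Longrightarrow> x \<in> {-1..1} \<Longrightarrow>
    dirichlet_deriv (\<lambda>t. f t + g t) x = dirichlet_deriv f x + dirichlet_deriv g x"
proof -
  assume c: "continuous_on {-1..1} f" "continuous_on {-1..1} g" "x \<in> {-1..1}"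
  have "integral {-1..1} (primitive (\<lambda>t. f t + g t)) = integral {-1..1} (\<lambda>x. primitive f x + primitive g x)"
    by (intro integral_cong primitive_add c)
  also have "\<dots> = integral {-1..1} (primitive f) + integral {-1..1} (primitive g)"
    by (intro integral_add integrable_continuous_real continuous_intros c)
  finally show ?thesis
    using c by (simp add: dirichlet_deriv_def primitive_add add_divide_distrib)
qed

lemma dirichlet_deriv_cmult: "dirichlet_deriv (\<lambda>t. c * f t) x = c * dirichlet_deriv f x"
  unfolding dirichlet_deriv_def primitive_cmult[abs_def] by (simp add: right_diff_distrib)

lemma dirichlet_deriv_cong: "(\<And>t. t \<in> {-1..1} \<Longrightarrow> f t = g t) \<Longrightarrow> x \<in> {-1..1} \<Longrightarrow> dirichlet_deriv f x = dirichlet_deriv g x"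
  unfolding dirichlet_deriv_def using primitive_cong[of f g] integral_cong[of "{-1..1}" "primitive f" "primitive g"] by simp

lemma dirichlet_add: "continuous_on {-1..1} f \<Longrightarrow> continuous_on {-1..1} g \<Longrightarrow> x \<in> {-1..1} \<Longrightarrow>
    dirichlet (\<lambda>t. f t + g t) x = dirichlet f x + dirichlet g x"
  unfolding dirichlet_def by (subst primitive_cong[OF dirichlet_deriv_add]) (auto intro!: primitive_add continuous_intros)

lemma dirichlet_cmult: "dirichlet (\<lambda>t. c * f t) x = c * dirichlet f x"
  unfolding dirichlet_def dirichlet_deriv_cmult[abs_def] primitive_cmult ..

lemma dirichlet_cong: "(\<And>t. t \<in> {-1..1} \<Longrightarrow> f t = g t) \<Longrightarrow> x \<in> {-1..1} \<Longrightarrow> dirichlet f x = dirichlet g x"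
  unfolding dirichlet_def by (intro primitive_cong dirichlet_deriv_cong)

section \<open>Bounds for the solution operator\<close>

text \<open>The bounds use the integral of the modulus rather than its maximum, because the later
  source terms contain u'' itself, which the norm controls only in the mean.\<close>

lemma primitive_bound:
  assumes "continuous_on {-1..1} f" "integral {-1..1} (\<lambda>t. \<bar>f t\<bar>) \<le> B" "x \<in> {-1..1}"
  shows "\<bar>primitive f x\<bar> \<le> B"
proof -
  have c: "continuous_on {-1..x} f" using assms by (auto elim: continuous_on_subset)
  have "\<bar>primitive f x\<bar> \<le> integral {-1..x} (\<lambda>t. \<bar>f t\<bar>)"
    unfolding primitive_def using integral_norm_bound_integral[of f "{-1..x}" "\<lambda>t. \<bar>f t\<bar>"] c
    by (auto intro!: integrable_continuous_real continuous_intros)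
  also have "\<dots> \<le> integral {-1..1} (\<lambda>t. \<bar>f t\<bar>)"
    using assms by (intro integral_subset_le integrable_continuous_real continuous_intros c) auto
  finally show ?thesis using assms by simp
qed

lemma integral_abs_le:
  fixes f :: "real \<Rightarrow> real"
  assumes "continuous_on {-1..1} f" "\<And>x. x \<in> {-1..1} \<Longrightarrow> \<bar>f x\<bar> \<le> B"
  shows "integral {-1..1} (\<lambda>t. \<bar>f t\<bar>) \<le> 2 * B"
proof -
  have "integral {-1..1} (\<lambda>t. \<bar>f t\<bar>) \<le> integral {-1..1::real} (\<lambda>_. B)"
    using assms by (intro integral_le integrable_continuous_real continuous_intros) auto
  then show ?thesis by simp
qed

lemma dirichlet_deriv_bound:
  assumes f: "continuous_on {-1..1} f" "integral {-1..1} (\<lambda>t. \<bar>f t\<bar>) \<le> B" "x \<in> {-1..1}"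
  shows "\<bar>dirichlet_deriv f x\<bar> \<le> 2 * B"
proof -
  have "\<bar>integral {-1..1} (primitive f)\<bar> \<le> integral {-1..1} (\<lambda>t. \<bar>primitive f t\<bar>)"
    using integral_norm_bound_integral[of "primitive f" "{-1..1}" "\<lambda>t. \<bar>primitive f t\<bar>"] f
    by (auto intro!: integrable_continuous_real continuous_intros)
  also have "\<dots> \<le> 2 * B"
    using f by (intro integral_abs_le primitive_bound continuous_intros) auto
  finally show ?thesis
    unfolding dirichlet_deriv_def using primitive_bound[OF f] by linarith
qed

lemma dirichlet_bound:
  assumes f: "continuous_on {-1..1} f" "integral {-1..1} (\<lambda>t. \<bar>f t\<bar>) \<le> B" "x \<in> {-1..1}"
  shows "\<bar>dirichlet f x\<bar> \<le> 4 * B"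
  unfolding dirichlet_def using f
  by (intro primitive_bound integral_abs_le[where B="2 * B", simplified] continuous_intros dirichlet_deriv_bound) auto

subsection \<open>Continuous functions with the \<open>L\<^sup>2\<close> inner product\<close>

definition clamp1 :: "real \<Rightarrow> real" where
  "clamp1 x = max (-1) (min 1 x)"

lemma clamp1_in [simp]: "clamp1 x \<in> {-1..1}" "clamp1 (clamp1 x) = clamp1 x"
  and clamp1_id [simp]: "x \<in> {-1..1} \<Longrightarrow> clamp1 x = x"
  by (auto simp: clamp1_def)

lemma clamp1_cont [continuous_intros]: "continuous_on UNIV clamp1"
  unfolding clamp1_def[abs_def] by (intro continuous_intros)

text \<open>Functions constant outside the interval, so that equality in the type is equality on
  \<open>[-1,1]\<close>.\<close>

typedef cfun = "{f :: real \<Rightarrow> real. continuous_on UNIV f \<and> (\<forall>x. f x = f (clamp1 x))}"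
  morphisms app Cfun
  by (rule exI[of _ "\<lambda>_. 0"]) simp

definition cfun_of :: "(real \<Rightarrow> real) \<Rightarrow> cfun" where
  "cfun_of f = Cfun (\<lambda>x. f (clamp1 x))"

lemma app_cont [continuous_intros]: "continuous_on S (app f)"
  using app[of f] by (auto elim: continuous_on_subset)

lemma app_clamp: "app f (clamp1 x) = app f x"
  using app[of f] by auto

lemma cfun_eqI:
  assumes "\<And>x. x \<in> {-1..1} \<Longrightarrow> app f x = app g x"
  shows "f = g"
proof -
  have "app f x = app g x" for x
    using assms[OF clamp1_in(1), of x] by (simp add: app_clamp)
  then show ?thesis by (metis app_inject ext)
qed

lemma app_cfun_of [simp]:
  assumes "continuous_on {-1..1} f" "x \<in> {-1..1}"
  shows "app (cfun_of f) x = f x"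
proof -
  have "continuous_on UNIV (\<lambda>x. f (clamp1 x))"
    by (rule continuous_on_compose2[OF assms(1) clamp1_cont]) (use clamp1_in(1) in blast)
  then have "app (cfun_of f) = (\<lambda>x. f (clamp1 x))"
    unfolding cfun_of_def by (intro Cfun_inverse) auto
  then show ?thesis using assms by simp
qed

instantiation cfun :: real_inner
begin

definition "0 = cfun_of (\<lambda>_. 0)"
definition "f + g = cfun_of (\<lambda>x. app f x + app g x)"
definition "f - g = cfun_of (\<lambda>x. app f x - app g x)"
definition "- f = cfun_of (\<lambda>x. - app f x)"
definition "scaleR c f = cfun_of (\<lambda>x. c * app f x)"
definition inner_cfun_def: "inner f g = integral {-1..1} (\<lambda>x. app f x * app g x)"
definition norm_cfun_def: "norm (f :: cfun) = sqrt (inner f f)"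
definition dist_cfun_def: "dist f (g :: cfun) = norm (f - g)"
definition sgn_cfun_def: "sgn f = inverse (norm (f :: cfun)) *\<^sub>R f"
definition uniformity_cfun_def [code del]:
  "(uniformity :: (cfun \<times> cfun) filter) = (INF e\<in>{0 <..}. principal {(x, y). dist x y < e})"
definition open_cfun_def [code del]:
  "open (U :: cfun set) \<longleftrightarrow> (\<forall>x\<in>U. eventually (\<lambda>(x', y). x' = x \<longrightarrow> y \<in> U) uniformity)"

lemma app_arith:
  assumes "x \<in> {-1..1}"
  shows "app 0 x = 0" "app (f + g) x = app f x + app g x" "app (f - g) x = app f x - app g x"
    "app (- f) x = - app f x" "app (c *\<^sub>R f) x = c * app f x"
  using assms
  by (auto simp: zero_cfun_def plus_cfun_def minus_cfun_def uminus_cfun_def scaleR_cfun_def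
      intro!: app_cfun_of continuous_intros)

instance
proof
  fix f g h :: cfun and c d :: real
  show "f + g + h = f + (g + h)" "f + g = g + f" "0 + f = f" "- f + f = 0" "f - g = f + - g"
    "c *\<^sub>R (f + g) = c *\<^sub>R f + c *\<^sub>R g" "(c + d) *\<^sub>R f = c *\<^sub>R f + d *\<^sub>R f"
    "c *\<^sub>R d *\<^sub>R f = (c * d) *\<^sub>R f" "1 *\<^sub>R f = f"
    by (rule cfun_eqI; simp add: app_arith algebra_simps)+
  show "dist f g = norm (f - g)" "norm f = sqrt (inner f f)" "sgn f = inverse (norm f) *\<^sub>R f"
    by (simp_all add: dist_cfun_def norm_cfun_def sgn_cfun_def)
  show "inner f g = inner g f" by (simp add: inner_cfun_def mult.commute)
  show "inner (f + g) h = inner f h + inner g h"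
  proof -
    have "inner (f + g) h = integral {-1..1} (\<lambda>x. app f x * app h x + app g x * app h x)"
      unfolding inner_cfun_def by (intro integral_cong) (simp add: app_arith algebra_simps)
    also have "\<dots> = inner f h + inner g h"
      unfolding inner_cfun_def
      by (intro integral_add integrable_continuous_real continuous_intros)
    finally show ?thesis .
  qed
  show "inner (c *\<^sub>R f) g = c * inner f g"
  proof -
    have "inner (c *\<^sub>R f) g = integral {-1..1} (\<lambda>x. c * (app f x * app g x))"
      unfolding inner_cfun_def by (intro integral_cong) (simp add: app_arith)
    then show ?thesis by (simp add: inner_cfun_def)
  qed
  show "0 \<le> inner f f"
    unfolding inner_cfun_def
    by (intro integral_nonneg integrable_continuous_real continuous_intros) auto
  show "inner f f = 0 \<longleftrightarrow> f = 0"
  proof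
    assume "inner f f = 0"
    then have "\<forall>x\<in>{-1..1}. app f x * app f x = 0"
      unfolding inner_cfun_def
      by (subst (asm) integral_eq_0_iff) (auto intro!: continuous_intros)
    then show "f = 0" by (intro cfun_eqI) (simp add: app_arith)
  next
    assume "f = 0"
    have "inner f f = integral {-1..1::real} (\<lambda>x. 0)"
      unfolding inner_cfun_def \<open>f = 0\<close> by (intro integral_cong) (simp add: app_arith)
    then show "inner f f = 0" by simp
  qed
qed (fact uniformity_cfun_def open_cfun_def)+

end

lemma norm_sq_cfun: "(norm f)\<^sup>2 = integral {-1..1} (\<lambda>x. (app f x)\<^sup>2)"
  unfolding power2_norm_eq_inner inner_cfun_def by (simp add: power2_eq_square)

lemma norm_cfun_le:
  assumes "\<And>x. x \<in> {-1..1} \<Longrightarrow> \<bar>app f x\<bar> \<le> B"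
  shows "norm f \<le> 2 * B"
proof -
  have B: "B \<ge> 0" using assms[of 0] by simp
  have "(norm f)\<^sup>2 \<le> integral {-1..1} (\<lambda>_::real. B\<^sup>2)"
    unfolding norm_sq_cfun using assms B
    by (intro integral_le integrable_continuous_real continuous_intros)
      (simp add: abs_le_square_iff[symmetric])
  also have "\<dots> \<le> (2 * B)\<^sup>2" by (simp add: power_mult_distrib)
  finally show ?thesis by (rule power2_le_imp_le) (use B in simp)
qed

text \<open>Cauchy-Schwarz, with the sharp factor sqrt 2 rounded up to 2.\<close>

lemma integral_abs_cfun: "integral {-1..1} (\<lambda>x. \<bar>app f x\<bar>) \<le> 2 * norm f"
proof -
  have "(integral {-1..1} (\<lambda>x. \<bar>app f x\<bar>))\<^sup>2 \<le> 2 * (norm f)\<^sup>2"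
    unfolding norm_sq_cfun
    using integral_sq_le[of "\<lambda>x. \<bar>app f x\<bar>"] by (simp add: continuous_intros)
  also have "\<dots> \<le> (2 * norm f)\<^sup>2" by (simp add: power_mult_distrib)
  finally show ?thesis by (rule power2_le_imp_le) simp
qed

text \<open>One-dimensional Sobolev embedding: u'' in the mean controls u' pointwise, end points
  included. This is what makes the slip terms bounded.\<close>

lemma dirichlet_deriv_app_bound: "x \<in> {-1..1} \<Longrightarrow> \<bar>dirichlet_deriv (app f) x\<bar> \<le> 4 * norm f"
  using dirichlet_deriv_bound[OF _ integral_abs_cfun] by (force intro: continuous_intros)

lemma dirichlet_app_bound: "x \<in> {-1..1} \<Longrightarrow> \<bar>dirichlet (app f) x\<bar> \<le> 8 * norm f"
  using dirichlet_bound[OF _ integral_abs_cfun] by (force intro: continuous_intros)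

lemma dirichlet_app_arith:
  assumes "x \<in> {-1..1}"
  shows "dirichlet_deriv (app (f + g)) x = dirichlet_deriv (app f) x + dirichlet_deriv (app g) x" "dirichlet_deriv (app (c *\<^sub>R f)) x = c * dirichlet_deriv (app f) x"
    "dirichlet (app (f + g)) x = dirichlet (app f) x + dirichlet (app g) x" "dirichlet (app (c *\<^sub>R f)) x = c * dirichlet (app f) x"
proof -
  have "dirichlet_deriv (app (f + g)) x = dirichlet_deriv (\<lambda>t. app f t + app g t) x" "dirichlet_deriv (app (c *\<^sub>R f)) x = dirichlet_deriv (\<lambda>t. c * app f t) x"
    "dirichlet (app (f + g)) x = dirichlet (\<lambda>t. app f t + app g t) x" "dirichlet (app (c *\<^sub>R f)) x = dirichlet (\<lambda>t. c * app f t) x"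
    using assms by (intro dirichlet_deriv_cong dirichlet_cong; simp add: app_arith)+
  with assms show "dirichlet_deriv (app (f + g)) x = dirichlet_deriv (app f) x + dirichlet_deriv (app g) x" "dirichlet_deriv (app (c *\<^sub>R f)) x = c * dirichlet_deriv (app f) x"
    "dirichlet (app (f + g)) x = dirichlet (app f) x + dirichlet (app g) x" "dirichlet (app (c *\<^sub>R f)) x = c * dirichlet (app f) x"
    by (simp_all add: dirichlet_deriv_add dirichlet_add dirichlet_deriv_cmult dirichlet_cmult continuous_intros)
qed

lemma dirichlet_app_sum:
  assumes "x \<in> {-1..1}"
  shows "dirichlet_deriv (app (\<Sum>i\<in>A. a i *\<^sub>R f i)) x = (\<Sum>i\<in>A. a i * dirichlet_deriv (app (f i)) x)"
    "dirichlet (app (\<Sum>i\<in>A. a i *\<^sub>R f i)) x = (\<Sum>i\<in>A. a i * dirichlet (app (f i)) x)"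
proof -
  have "dirichlet_deriv (app 0) x = 0" "dirichlet (app 0) x = 0"
    using dirichlet_app_arith(2,4)[OF assms, of 0 0] by simp_all
  then show "dirichlet_deriv (app (\<Sum>i\<in>A. a i *\<^sub>R f i)) x = (\<Sum>i\<in>A. a i * dirichlet_deriv (app (f i)) x)"
    "dirichlet (app (\<Sum>i\<in>A. a i *\<^sub>R f i)) x = (\<Sum>i\<in>A. a i * dirichlet (app (f i)) x)"
    by (induction A rule: infinite_finite_induct) (auto simp: dirichlet_app_arith[OF assms])
qed

section \<open>The operator of the eigenvalue problem\<close>

text \<open>The coefficients are arbitrary functions so that the difference of two operators of the
  family has the same shape.\<close>

definition lower_order :: "(real \<Rightarrow> real) \<Rightarrow> (real \<Rightarrow> real) \<Rightarrow> (real \<Rightarrow> real) \<Rightarrow> (real \<Rightarrow> real) \<Rightarrow> real \<Rightarrow> real" where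
  "lower_order \<alpha> \<beta> \<gamma> h t = \<alpha> t * dirichlet h t + \<beta> t * dirichlet_deriv h t + \<gamma> t * h t"

lemma lower_order_cont [continuous_intros]:
  "continuous_on {-1..1} \<alpha> \<Longrightarrow> continuous_on {-1..1} \<beta> \<Longrightarrow> continuous_on {-1..1} \<gamma> \<Longrightarrow>
    continuous_on {-1..1} h \<Longrightarrow> continuous_on {-1..1} (lower_order \<alpha> \<beta> \<gamma> h)"
  unfolding lower_order_def by (intro continuous_intros)

text \<open>26 = 2 * (8 + 4) + 2: the length of the interval times the pointwise bounds of u and u',
  plus the mean bound of u''.\<close>

lemma integral_abs_lower_order:
  assumes c: "continuous_on {-1..1} \<alpha>" "continuous_on {-1..1} \<beta>" "continuous_on {-1..1} \<gamma>"
    and b: "\<And>t. t \<in> {-1..1} \<Longrightarrow> \<bar>\<alpha> t\<bar> \<le> B" "\<And>t. t \<in> {-1..1} \<Longrightarrow> \<bar>\<beta> t\<bar> \<le> B"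
      "\<And>t. t \<in> {-1..1} \<Longrightarrow> \<bar>\<gamma> t\<bar> \<le> B"
  shows "integral {-1..1} (\<lambda>t. \<bar>lower_order \<alpha> \<beta> \<gamma> (app x) t\<bar>) \<le> 26 * B * norm x"
proof -
  have B: "B \<ge> 0" using b(1)[of 0] by simp
  have "integral {-1..1} (\<lambda>t. \<bar>lower_order \<alpha> \<beta> \<gamma> (app x) t\<bar>)
      \<le> integral {-1..1} (\<lambda>t. 12 * B * norm x + B * \<bar>app x t\<bar>)"
  proof (intro integral_le integrable_continuous_real continuous_intros c)
    fix t :: real assume t: "t \<in> {-1..1}"
    have "\<bar>lower_order \<alpha> \<beta> \<gamma> (app x) t\<bar> \<le> \<bar>\<alpha> t\<bar> * \<bar>dirichlet (app x) t\<bar> + \<bar>\<beta> t\<bar> * \<bar>dirichlet_deriv (app x) t\<bar> + \<bar>\<gamma> t\<bar> * \<bar>app x t\<bar>"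
      unfolding lower_order_def abs_mult[symmetric] by linarith
    also have "\<dots> \<le> B * (8 * norm x) + B * (4 * norm x) + B * \<bar>app x t\<bar>"
      by (intro add_mono mult_mono b dirichlet_app_bound dirichlet_deriv_app_bound t) (use B in auto)
    finally show "\<bar>lower_order \<alpha> \<beta> \<gamma> (app x) t\<bar> \<le> 12 * B * norm x + B * \<bar>app x t\<bar>" by simp
  qed
  also have "\<dots> = 24 * B * norm x + B * integral {-1..1} (\<lambda>t. \<bar>app x t\<bar>)"
    by (subst integral_add) (auto intro!: integrable_continuous_real continuous_intros)
  also have "\<dots> \<le> 24 * B * norm x + B * (2 * norm x)"
    using B by (intro add_left_mono mult_left_mono integral_abs_cfun)
  finally show ?thesis by simp
qed

lemma lipschitz_by_deriv:
  fixes f :: "real \<Rightarrow> real"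
  assumes "\<And>x. x \<in> {a..b} \<Longrightarrow> (f has_real_derivative f' x) (at x within {a..b})"
    and "\<And>x. x \<in> {a..b} \<Longrightarrow> \<bar>f' x\<bar> \<le> B" and "x \<in> {a..b}" "y \<in> {a..b}"
  shows "\<bar>f x - f y\<bar> \<le> B * \<bar>x - y\<bar>"
  using field_differentiable_bound[of "{a..b}" f f' B y x] assms by (simp add: abs_minus_commute)

locale rayleigh_taylor =
  fixes g \<mu> \<xi>m \<xi>p k :: real and \<rho> \<rho>' :: "real \<Rightarrow> real"
  assumes g_pos: "g > 0" and \<mu>_pos: "\<mu> > 0" and \<xi>_nonneg: "\<xi>m \<ge> 0" "\<xi>p \<ge> 0" and k_nz: "k \<noteq> 0"
    and \<rho>_deriv: "\<And>x. x \<in> {-1..1} \<Longrightarrow> (\<rho> has_real_derivative \<rho>' x) (at x within {-1..1})"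
    and \<rho>'_cont [continuous_intros]: "continuous_on {-1..1} \<rho>'"
    and \<rho>'_pos: "\<And>x. x \<in> {-1..1} \<Longrightarrow> \<rho>' x > 0" and \<rho>_left: "\<rho> (-1) > 0"
begin

lemma \<rho>_cont [continuous_intros]: "continuous_on {-1..1} \<rho>"
  by (rule continuous_on_by_deriv[OF \<rho>_deriv])

lemma \<rho>_pos: "x \<in> {-1..1} \<Longrightarrow> \<rho> x > 0"
proof -
  assume x: "x \<in> {-1..1}"
  have "\<rho> (-1) \<le> \<rho> x"
  proof (rule DERIV_nonneg_imp_increasing_open[where f=\<rho> and a="-1" and b=x])
    show "continuous_on {-1..x} \<rho>"
      using x by (auto intro: continuous_on_subset[OF \<rho>_cont])
    fix y assume "-1 < y" "y < x"
    with x have "y \<in> {-1..1}" "at y within {-1..1} = at y"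
      by (auto intro: at_within_Icc_at)
    then show "\<exists>d. (\<rho> has_real_derivative d) (at y) \<and> 0 \<le> d"
      using \<rho>_deriv[of y] \<rho>'_pos[of y] by auto
  qed (use x in auto)
  with \<rho>_left show ?thesis by simp
qed

lemma \<rho>_bounded: "\<exists>R>0. \<forall>x\<in>{-1..1}. \<rho> x \<le> R \<and> \<rho>' x \<le> R"
proof -
  obtain a b where "\<forall>x\<in>{-1..1}. \<rho> x \<le> \<rho> a" "\<forall>x\<in>{-1..1}. \<rho>' x \<le> \<rho>' b"
    using continuous_attains_sup[of "{-1..1}" \<rho>] continuous_attains_sup[of "{-1..1}" \<rho>'] \<rho>_cont \<rho>'_cont
    by auto
  then show ?thesis
    by (intro exI[of _ "\<bar>\<rho> a\<bar> + \<bar>\<rho>' b\<bar> + 1"]) fastforce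
qed

text \<open>For \<open>h = u''\<close> the function \<open>S \<kappa> h\<close> satisfies \<open>(S \<kappa> h)'' = \<alpha> u + \<beta> u' + \<gamma> u'' = \<alpha> u + (\<gamma> u')'\<close>,
  and its boundary values are those that \<open>- \<mu> u''\<close> has under the slip conditions. So \<open>\<mu> h + S \<kappa> h = 0\<close>
  is the whole boundary value problem, divided by \<open>\<kappa>\<close>.\<close>

definition \<alpha> :: "real \<Rightarrow> real \<Rightarrow> real" where
  "\<alpha> \<kappa> t = k^4 * \<mu> + \<kappa> * k\<^sup>2 * \<rho> t - g * k\<^sup>2 / \<kappa> * \<rho>' t"
definition \<beta> :: "real \<Rightarrow> real \<Rightarrow> real" where
  "\<beta> \<kappa> t = - \<kappa> * \<rho>' t"
definition \<gamma> :: "real \<Rightarrow> real \<Rightarrow> real" where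
  "\<gamma> \<kappa> t = - (2 * k\<^sup>2 * \<mu> + \<kappa> * \<rho> t)"
text \<open>Affine in t, so it adjusts the boundary values without touching the second
  derivative.\<close>

definition bc :: "(real \<Rightarrow> real) \<Rightarrow> real \<Rightarrow> real" where
  "bc h t = \<xi>m * dirichlet_deriv h (-1) * ((1 - t) / 2) - \<xi>p * dirichlet_deriv h 1 * ((1 + t) / 2)"
definition bc' :: "(real \<Rightarrow> real) \<Rightarrow> real" where
  "bc' h = - (\<xi>m * dirichlet_deriv h (-1) + \<xi>p * dirichlet_deriv h 1) / 2"
definition S :: "real \<Rightarrow> (real \<Rightarrow> real) \<Rightarrow> real \<Rightarrow> real" where
  "S \<kappa> h t = dirichlet (lower_order (\<alpha> \<kappa>) (\<beta> \<kappa>) (\<gamma> \<kappa>) h) t + bc h t"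
definition S' :: "real \<Rightarrow> (real \<Rightarrow> real) \<Rightarrow> real \<Rightarrow> real" where
  "S' \<kappa> h t = dirichlet_deriv (lower_order (\<alpha> \<kappa>) (\<beta> \<kappa>) (\<gamma> \<kappa>) h) t + bc' h"
definition K :: "real \<Rightarrow> cfun \<Rightarrow> cfun" where
  "K \<kappa> x = cfun_of (S \<kappa> (app x))"
text \<open>The weak form of everything except the fourth-order term. Unlike \<open>K\<close>, it is
  symmetric on sight; \<beta> is absorbed because it is the derivative of \<gamma>.\<close>

definition Q :: "real \<Rightarrow> cfun \<Rightarrow> cfun \<Rightarrow> real" where
  "Q \<kappa> x y = integral {-1..1} (\<lambda>t. \<alpha> \<kappa> t * (dirichlet (app x) t * dirichlet (app y) t) - \<gamma> \<kappa> t * (dirichlet_deriv (app x) t * dirichlet_deriv (app y) t))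
     - \<xi>p * (dirichlet_deriv (app x) 1 * dirichlet_deriv (app y) 1) - \<xi>m * (dirichlet_deriv (app x) (-1) * dirichlet_deriv (app y) (-1))"

lemma coeff_cont [continuous_intros]:
  "continuous_on {-1..1} (\<alpha> \<kappa>)" "continuous_on {-1..1} (\<beta> \<kappa>)" "continuous_on {-1..1} (\<gamma> \<kappa>)"
  unfolding \<alpha>_def[abs_def] \<beta>_def[abs_def] \<gamma>_def[abs_def] by (intro continuous_intros)+

lemma \<gamma>_deriv: "t \<in> {-1..1} \<Longrightarrow> (\<gamma> \<kappa> has_real_derivative \<beta> \<kappa> t) (at t within {-1..1})"
  unfolding \<gamma>_def[abs_def] \<beta>_def by (auto intro!: derivative_eq_intros \<rho>_deriv)

lemma S_deriv: "continuous_on {-1..1} h \<Longrightarrow> t \<in> {-1..1} \<Longrightarrow>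
    (S \<kappa> h has_real_derivative S' \<kappa> h t) (at t within {-1..1})"
  unfolding S_def[abs_def] S'_def bc_def bc'_def
  by (auto intro!: derivative_eq_intros dirichlet_deriv continuous_intros simp: field_simps)

lemma S'_deriv: "continuous_on {-1..1} h \<Longrightarrow> t \<in> {-1..1} \<Longrightarrow>
    (S' \<kappa> h has_real_derivative lower_order (\<alpha> \<kappa>) (\<beta> \<kappa>) (\<gamma> \<kappa>) h t) (at t within {-1..1})"
  unfolding S'_def[abs_def] by (auto intro!: derivative_eq_intros dirichlet_deriv_deriv continuous_intros)

lemma S_cont [continuous_intros]: "continuous_on {-1..1} h \<Longrightarrow> continuous_on {-1..1} (S \<kappa> h)"
  by (rule continuous_on_by_deriv[OF S_deriv])

lemma S'_cont [continuous_intros]: "continuous_on {-1..1} h \<Longrightarrow> continuous_on {-1..1} (S' \<kappa> h)"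
  by (rule continuous_on_by_deriv[OF S'_deriv])

lemma S_boundary:
  "continuous_on {-1..1} h \<Longrightarrow> S \<kappa> h (-1) = \<xi>m * dirichlet_deriv h (-1)"
  "continuous_on {-1..1} h \<Longrightarrow> S \<kappa> h 1 = - \<xi>p * dirichlet_deriv h 1"
  by (auto simp: S_def bc_def continuous_intros)

lemma app_K: "t \<in> {-1..1} \<Longrightarrow> app (K \<kappa> x) t = S \<kappa> (app x) t"
  unfolding K_def by (intro app_cfun_of continuous_intros)

text \<open>With w = \<open>dirichlet v\<close>, so that v = w'', two integrations by parts move
  both derivatives to \<open>S\<close>. The end values of w' are free, so the boundary values of
  \<open>S\<close> leave the slip terms; w itself vanishes at the ends, which permits a further
  integration by parts of (\<gamma> u')' against w.\<close>

lemma inner_K: "inner (K \<kappa> x) y = Q \<kappa> x y"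
proof -
  define h where "h = app x"
  define v where "v = app y"
  have h: "continuous_on {-1..1} h" and v: "continuous_on {-1..1} v"
    by (auto simp: h_def v_def continuous_intros)
  define f where "f = lower_order (\<alpha> \<kappa>) (\<beta> \<kappa>) (\<gamma> \<kappa>) h"
  note D = dirichlet_deriv[OF v] dirichlet_deriv_deriv[OF v] S_deriv[OF h] S'_deriv[OF h, where \<kappa>=\<kappa>, folded f_def] dirichlet_deriv_deriv[OF h] \<gamma>_deriv
  have fc: "continuous_on {-1..1} f" unfolding f_def by (intro continuous_intros h)
  have "inner (K \<kappa> x) y = integral {-1..1} (\<lambda>t. S \<kappa> h t * v t)"
    unfolding inner_cfun_def by (intro integral_cong) (simp add: app_K h_def v_def)
  also have "\<dots> = S \<kappa> h 1 * dirichlet_deriv v 1 - S \<kappa> h (-1) * dirichlet_deriv v (-1) - integral {-1..1} (\<lambda>t. S' \<kappa> h t * dirichlet_deriv v t)"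
    by (rule integral_by_parts_Icc) (auto intro!: D continuous_intros h v)
  also have "integral {-1..1} (\<lambda>t. S' \<kappa> h t * dirichlet_deriv v t) = - integral {-1..1} (\<lambda>t. f t * dirichlet v t)"
    using v by (subst integral_by_parts_Icc[OF _ D(4) D(1)]) (auto intro!: continuous_intros fc)
  also have "integral {-1..1} (\<lambda>t. f t * dirichlet v t)
      = integral {-1..1} (\<lambda>t. \<alpha> \<kappa> t * (dirichlet h t * dirichlet v t) + dirichlet v t * (\<beta> \<kappa> t * dirichlet_deriv h t + \<gamma> \<kappa> t * h t))"
    unfolding f_def lower_order_def by (simp add: algebra_simps)
  also have "\<dots> = integral {-1..1} (\<lambda>t. \<alpha> \<kappa> t * (dirichlet h t * dirichlet v t))
      + integral {-1..1} (\<lambda>t. dirichlet v t * (\<beta> \<kappa> t * dirichlet_deriv h t + \<gamma> \<kappa> t * h t))"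
    by (intro integral_add integrable_continuous_real continuous_intros h v)
  also have "integral {-1..1} (\<lambda>t. dirichlet v t * (\<beta> \<kappa> t * dirichlet_deriv h t + \<gamma> \<kappa> t * h t))
      = - integral {-1..1} (\<lambda>t. dirichlet_deriv v t * (\<gamma> \<kappa> t * dirichlet_deriv h t))"
  proof (subst integral_by_parts_Icc[OF _ D(1)])
    show "((\<lambda>t. \<gamma> \<kappa> t * dirichlet_deriv h t) has_real_derivative \<beta> \<kappa> t * dirichlet_deriv h t + \<gamma> \<kappa> t * h t) (at t within {-1..1})"
      if "t \<in> {-1..1}" for t
      by (rule derivative_eq_intros D that refl)+ (simp add: algebra_simps)
  qed (auto intro!: continuous_intros h v simp: v)
  also have "integral {-1..1} (\<lambda>t. \<alpha> \<kappa> t * (dirichlet h t * dirichlet v t)) + - integral {-1..1} (\<lambda>t. dirichlet_deriv v t * (\<gamma> \<kappa> t * dirichlet_deriv h t))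
      = integral {-1..1} (\<lambda>t. \<alpha> \<kappa> t * (dirichlet h t * dirichlet v t) - \<gamma> \<kappa> t * (dirichlet_deriv h t * dirichlet_deriv v t))"
    by (subst integral_diff) (auto intro!: integrable_continuous_real continuous_intros h v simp: mult_ac)
  finally show ?thesis
    by (simp add: Q_def S_boundary[OF h, unfolded h_def] h_def v_def)
qed

lemma Q_sym: "Q \<kappa> x y = Q \<kappa> y x"
  by (simp add: Q_def mult_ac)

lemma linear_K: "linear (K \<kappa>)"
proof (rule linearI)
  have c: "continuous_on {-1..1} (lower_order (\<alpha> \<kappa>) (\<beta> \<kappa>) (\<gamma> \<kappa>) (app x))" for x
    by (intro continuous_intros)
  fix x y :: cfun and c :: real
  show "K \<kappa> (x + y) = K \<kappa> x + K \<kappa> y"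
  proof (rule cfun_eqI)
    fix t :: real assume t: "t \<in> {-1..1}"
    have "dirichlet (lower_order (\<alpha> \<kappa>) (\<beta> \<kappa>) (\<gamma> \<kappa>) (app (x + y))) t
        = dirichlet (\<lambda>t. lower_order (\<alpha> \<kappa>) (\<beta> \<kappa>) (\<gamma> \<kappa>) (app x) t + lower_order (\<alpha> \<kappa>) (\<beta> \<kappa>) (\<gamma> \<kappa>) (app y) t) t"
      using t by (intro dirichlet_cong) (simp_all add: lower_order_def dirichlet_app_arith app_arith algebra_simps)
    then show "app (K \<kappa> (x + y)) t = app (K \<kappa> x + K \<kappa> y) t"
      using t by (simp add: app_K app_arith S_def bc_def dirichlet_add[OF c c] dirichlet_app_arith field_simps)
  qed
  show "K \<kappa> (c *\<^sub>R x) = c *\<^sub>R K \<kappa> x"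
  proof (rule cfun_eqI)
    fix t :: real assume t: "t \<in> {-1..1}"
    have "dirichlet (lower_order (\<alpha> \<kappa>) (\<beta> \<kappa>) (\<gamma> \<kappa>) (app (c *\<^sub>R x))) t
        = dirichlet (\<lambda>t. c * lower_order (\<alpha> \<kappa>) (\<beta> \<kappa>) (\<gamma> \<kappa>) (app x) t) t"
      using t by (intro dirichlet_cong) (simp_all add: lower_order_def dirichlet_app_arith app_arith algebra_simps)
    then show "app (K \<kappa> (c *\<^sub>R x)) t = app (c *\<^sub>R K \<kappa> x) t"
      using t by (simp add: app_K app_arith S_def bc_def dirichlet_cmult dirichlet_app_arith field_simps)
  qed
qed


section \<open>Uniform estimates and compactness for \<kappa> away from 0\<close>

lemma coeff_bounded:
  assumes "0 < \<delta>"
  shows "\<exists>B>0. (\<forall>\<kappa>\<in>{\<delta>..\<epsilon>}. \<forall>t\<in>{-1..1}. \<bar>\<alpha> \<kappa> t\<bar> \<le> B \<and> \<bar>\<beta> \<kappa> t\<bar> \<le> B \<and> \<bar>\<gamma> \<kappa> t\<bar> \<le> B) \<and>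
    (\<forall>\<kappa>\<in>{\<delta>..\<epsilon>}. \<forall>\<kappa>'\<in>{\<delta>..\<epsilon>}. \<forall>t\<in>{-1..1}. \<bar>\<alpha> \<kappa> t - \<alpha> \<kappa>' t\<bar> \<le> B * \<bar>\<kappa> - \<kappa>'\<bar> \<and>
      \<bar>\<beta> \<kappa> t - \<beta> \<kappa>' t\<bar> \<le> B * \<bar>\<kappa> - \<kappa>'\<bar> \<and> \<bar>\<gamma> \<kappa> t - \<gamma> \<kappa>' t\<bar> \<le> B * \<bar>\<kappa> - \<kappa>'\<bar>)"
proof -
  obtain R where R: "R > 0" "\<And>x. x \<in> {-1..1} \<Longrightarrow> \<rho> x \<le> R \<and> \<rho>' x \<le> R"
    using \<rho>_bounded by blast
  define B1 where "B1 = k^4 * \<mu> + \<epsilon> * k\<^sup>2 * R + g * k\<^sup>2 / \<delta> * R"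
  define B3 where "B3 = 2 * k\<^sup>2 * \<mu> + \<epsilon> * R"
  define L1 where "L1 = k\<^sup>2 * R + g * k\<^sup>2 * R / \<delta>\<^sup>2"
  define B where "B = \<bar>B1\<bar> + \<bar>B3\<bar> + \<bar>\<epsilon> * R\<bar> + \<bar>L1\<bar> + R"
  have "B > 0" unfolding B_def using R by linarith
  moreover have "\<bar>\<alpha> \<kappa> t\<bar> \<le> B \<and> \<bar>\<beta> \<kappa> t\<bar> \<le> B \<and> \<bar>\<gamma> \<kappa> t\<bar> \<le> B"
    if \<kappa>: "\<kappa> \<in> {\<delta>..\<epsilon>}" and t: "t \<in> {-1..1}" for \<kappa> t
  proof -
    have pos: "\<kappa> > 0" "\<rho> t > 0" "\<rho>' t > 0" "\<rho> t \<le> R" "\<rho>' t \<le> R"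
      using \<kappa> assms \<rho>_pos[OF t] \<rho>'_pos[OF t] R(2)[OF t] by auto
    have 1: "0 \<le> \<kappa> * k\<^sup>2 * \<rho> t" "\<kappa> * k\<^sup>2 * \<rho> t \<le> \<epsilon> * k\<^sup>2 * R"
      using pos \<kappa> by (auto intro!: mult_nonneg_nonneg mult_mono)
    have "g * k\<^sup>2 / \<kappa> \<le> g * k\<^sup>2 / \<delta>"
      using pos \<kappa> assms g_pos by (intro divide_left_mono mult_nonneg_nonneg mult_pos_pos) auto
    then have "g * k\<^sup>2 / \<kappa> * \<rho>' t \<le> g * k\<^sup>2 / \<delta> * R"
      using pos assms g_pos by (intro mult_mono) auto
    moreover have "0 \<le> g * k\<^sup>2 / \<kappa> * \<rho>' t" using pos g_pos by auto
    ultimately have 2: "0 \<le> g * k\<^sup>2 / \<kappa> * \<rho>' t" "g * k\<^sup>2 / \<kappa> * \<rho>' t \<le> g * k\<^sup>2 / \<delta> * R"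
      by auto
    have 3: "0 \<le> \<kappa> * \<rho> t" "\<kappa> * \<rho> t \<le> \<epsilon> * R" "0 \<le> \<kappa> * \<rho>' t" "\<kappa> * \<rho>' t \<le> \<epsilon> * R"
      using pos \<kappa> by (auto intro!: mult_mono)
    have 4: "0 \<le> k^4 * \<mu>" "0 \<le> 2 * k\<^sup>2 * \<mu>" using \<mu>_pos by auto
    show ?thesis
      unfolding \<alpha>_def \<beta>_def \<gamma>_def B_def B1_def B3_def using 1 2 3 4 R(1)
      by (intro conjI; linarith)
  qed
  moreover have "\<bar>\<alpha> \<kappa> t - \<alpha> \<kappa>' t\<bar> \<le> B * \<bar>\<kappa> - \<kappa>'\<bar> \<and>
      \<bar>\<beta> \<kappa> t - \<beta> \<kappa>' t\<bar> \<le> B * \<bar>\<kappa> - \<kappa>'\<bar> \<and> \<bar>\<gamma> \<kappa> t - \<gamma> \<kappa>' t\<bar> \<le> B * \<bar>\<kappa> - \<kappa>'\<bar>"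
    if \<kappa>: "\<kappa> \<in> {\<delta>..\<epsilon>}" "\<kappa>' \<in> {\<delta>..\<epsilon>}" and t: "t \<in> {-1..1}" for \<kappa> \<kappa>' t
  proof -
    have pos: "\<kappa> > 0" "\<kappa>' > 0" "\<rho> t > 0" "\<rho>' t > 0" "\<rho> t \<le> R" "\<rho>' t \<le> R"
      using \<kappa> assms \<rho>_pos[OF t] \<rho>'_pos[OF t] R(2)[OF t] by auto
    \<comment> \<open>By 1/\<kappa>' - 1/\<kappa> = (\<kappa> - \<kappa>') / (\<kappa> \<kappa>'),
      and \<kappa> \<kappa>' is at least \<delta>^2; hence the form of \<open>L1\<close>.\<close>
    have "\<alpha> \<kappa> t - \<alpha> \<kappa>' t = (k\<^sup>2 * \<rho> t + g * k\<^sup>2 * \<rho>' t / (\<kappa> * \<kappa>')) * (\<kappa> - \<kappa>')"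
      using pos by (simp add: \<alpha>_def field_simps)
    moreover have "\<bar>k\<^sup>2 * \<rho> t + g * k\<^sup>2 * \<rho>' t / (\<kappa> * \<kappa>')\<bar> \<le> B"
    proof -
      have "\<bar>k\<^sup>2 * \<rho> t + g * k\<^sup>2 * \<rho>' t / (\<kappa> * \<kappa>')\<bar> = k\<^sup>2 * \<rho> t + g * k\<^sup>2 * \<rho>' t / (\<kappa> * \<kappa>')"
        using pos g_pos by (intro abs_of_nonneg add_nonneg_nonneg mult_nonneg_nonneg divide_nonneg_nonneg) auto
      also have "\<dots> \<le> L1"
        unfolding L1_def power2_eq_square[of \<delta>] using pos g_pos \<kappa> assms
        by (intro add_mono mult_left_mono frac_le mult_mono mult_nonneg_nonneg) auto
      finally show ?thesis using R(1) by (simp add: B_def)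
    qed
    ultimately have 1: "\<bar>\<alpha> \<kappa> t - \<alpha> \<kappa>' t\<bar> \<le> B * \<bar>\<kappa> - \<kappa>'\<bar>"
      by (simp add: abs_mult mult_right_mono)
    have RB: "R \<le> B" unfolding B_def by linarith
    have "\<beta> \<kappa> t - \<beta> \<kappa>' t = - \<rho>' t * (\<kappa> - \<kappa>')" "\<gamma> \<kappa> t - \<gamma> \<kappa>' t = - \<rho> t * (\<kappa> - \<kappa>')"
      by (simp_all add: \<beta>_def \<gamma>_def algebra_simps)
    with 1 show ?thesis
      using pos RB by (simp add: abs_mult mult_right_mono)
  qed
  ultimately show ?thesis by blast
qed

lemma bc_bound:
  assumes t: "t \<in> {-1..1}"
  shows "\<bar>bc (app x) t\<bar> \<le> 4 * (\<xi>m + \<xi>p) * norm x" "\<bar>bc' (app x)\<bar> \<le> 4 * (\<xi>m + \<xi>p) * norm x"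
proof -
  have D: "\<bar>\<xi>m * dirichlet_deriv (app x) (-1)\<bar> \<le> \<xi>m * (4 * norm x)" "\<bar>\<xi>p * dirichlet_deriv (app x) 1\<bar> \<le> \<xi>p * (4 * norm x)"
    using \<xi>_nonneg by (auto simp: abs_mult intro!: mult_left_mono dirichlet_deriv_app_bound)
  have "\<bar>\<xi>m * dirichlet_deriv (app x) (-1) * ((1 - t) / 2)\<bar> \<le> \<xi>m * (4 * norm x) * 1"
    "\<bar>\<xi>p * dirichlet_deriv (app x) 1 * ((1 + t) / 2)\<bar> \<le> \<xi>p * (4 * norm x) * 1"
    unfolding abs_mult[of _ "_ / 2"] using t \<xi>_nonneg by (intro mult_mono D; auto)+
  from order_trans[OF abs_triangle_ineq4 add_mono[OF this]]
  show "\<bar>bc (app x) t\<bar> \<le> 4 * (\<xi>m + \<xi>p) * norm x"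
    unfolding bc_def by (simp add: algebra_simps)
  show "\<bar>bc' (app x)\<bar> \<le> 4 * (\<xi>m + \<xi>p) * norm x"
    unfolding bc'_def using D by (simp add: algebra_simps)
qed

text \<open>On the unit ball \<open>S\<close> and its derivative are bounded uniformly in \<kappa>,
  so the images form a bounded equicontinuous family. Arzela-Ascoli gives a uniform, hence
  continuous limit, and uniform convergence implies convergence in norm.\<close>

lemma compact_family_K:
  assumes "0 < \<delta>"
  shows "\<exists>C. compact_family K \<mu> \<delta> \<epsilon> C"
proof -
  obtain B where B: "B > 0"
    "\<And>\<kappa> t. \<kappa> \<in> {\<delta>..\<epsilon>} \<Longrightarrow> t \<in> {-1..1} \<Longrightarrow> \<bar>\<alpha> \<kappa> t\<bar> \<le> B \<and> \<bar>\<beta> \<kappa> t\<bar> \<le> B \<and> \<bar>\<gamma> \<kappa> t\<bar> \<le> B"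
    "\<And>\<kappa> \<kappa>' t. \<kappa> \<in> {\<delta>..\<epsilon>} \<Longrightarrow> \<kappa>' \<in> {\<delta>..\<epsilon>} \<Longrightarrow> t \<in> {-1..1} \<Longrightarrow> \<bar>\<alpha> \<kappa> t - \<alpha> \<kappa>' t\<bar> \<le> B * \<bar>\<kappa> - \<kappa>'\<bar> \<and>
      \<bar>\<beta> \<kappa> t - \<beta> \<kappa>' t\<bar> \<le> B * \<bar>\<kappa> - \<kappa>'\<bar> \<and> \<bar>\<gamma> \<kappa> t - \<gamma> \<kappa>' t\<bar> \<le> B * \<bar>\<kappa> - \<kappa>'\<bar>"
    using coeff_bounded[OF assms, of \<epsilon>] by blast
  \<comment> \<open>104 = 4 * 26 comes from \<open>dirichlet_bound\<close> and also covers the 52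
    needed for the derivative; the rest bounds \<open>bc\<close> and \<open>bc'\<close>.\<close>
  define M where "M = 104 * B + 4 * (\<xi>m + \<xi>p)"
  have M: "M > 0" using B(1) \<xi>_nonneg by (simp add: M_def)
  have int: "integral {-1..1} (\<lambda>t. \<bar>lower_order (\<alpha> \<kappa>) (\<beta> \<kappa>) (\<gamma> \<kappa>) (app x) t\<bar>) \<le> 26 * B * norm x"
    if "\<kappa> \<in> {\<delta>..\<epsilon>}" for \<kappa> x
    using B(2)[OF that] by (intro integral_abs_lower_order continuous_intros) auto
  have Sb: "\<bar>S \<kappa> (app x) t\<bar> \<le> M * norm x" "\<bar>S' \<kappa> (app x) t\<bar> \<le> M * norm x"
    if "\<kappa> \<in> {\<delta>..\<epsilon>}" "t \<in> {-1..1}" for \<kappa> x t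
  proof -
    have "\<bar>dirichlet (lower_order (\<alpha> \<kappa>) (\<beta> \<kappa>) (\<gamma> \<kappa>) (app x)) t\<bar> \<le> 4 * (26 * B * norm x)"
      "\<bar>dirichlet_deriv (lower_order (\<alpha> \<kappa>) (\<beta> \<kappa>) (\<gamma> \<kappa>) (app x)) t\<bar> \<le> 2 * (26 * B * norm x)"
      by (intro dirichlet_bound dirichlet_deriv_bound int that continuous_intros)+
    moreover have "0 \<le> B * norm x" using B(1) by simp
    ultimately show "\<bar>S \<kappa> (app x) t\<bar> \<le> M * norm x" "\<bar>S' \<kappa> (app x) t\<bar> \<le> M * norm x"
      unfolding S_def S'_def M_def using bc_bound[OF that(2), of x] by (simp_all add: algebra_simps)
  qed
  have lip: "norm (K \<kappa> x - K \<kappa>' x) \<le> 208 * B * \<bar>\<kappa> - \<kappa>'\<bar> * norm x"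
    if \<kappa>: "\<kappa> \<in> {\<delta>..\<epsilon>}" "\<kappa>' \<in> {\<delta>..\<epsilon>}" for \<kappa> \<kappa>' x
  proof -
    \<comment> \<open>\<open>bc\<close> does not depend on \<kappa>, so it cancels, and the
      difference is driven by the differences of the coefficients alone.\<close>
    let ?s = "lower_order (\<lambda>t. \<alpha> \<kappa> t - \<alpha> \<kappa>' t) (\<lambda>t. \<beta> \<kappa> t - \<beta> \<kappa>' t) (\<lambda>t. \<gamma> \<kappa> t - \<gamma> \<kappa>' t) (app x)"
    have c: "continuous_on {-1..1} ?s" by (intro continuous_intros)
    have "norm (K \<kappa> x - K \<kappa>' x) \<le> 2 * (4 * (26 * (B * \<bar>\<kappa> - \<kappa>'\<bar>) * norm x))"
    proof (rule norm_cfun_le)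
      fix t :: real assume t: "t \<in> {-1..1}"
      have "dirichlet (lower_order (\<alpha> \<kappa>) (\<beta> \<kappa>) (\<gamma> \<kappa>) (app x)) t
          = dirichlet (\<lambda>t. ?s t + lower_order (\<alpha> \<kappa>') (\<beta> \<kappa>') (\<gamma> \<kappa>') (app x) t) t"
        by (rule dirichlet_cong[OF _ t]) (simp add: lower_order_def algebra_simps)
      also have "\<dots> = dirichlet ?s t + dirichlet (lower_order (\<alpha> \<kappa>') (\<beta> \<kappa>') (\<gamma> \<kappa>') (app x)) t"
        by (intro dirichlet_add t continuous_intros)
      finally have "app (K \<kappa> x - K \<kappa>' x) t = dirichlet ?s t"
        using t by (simp add: app_arith app_K S_def)
      then show "\<bar>app (K \<kappa> x - K \<kappa>' x) t\<bar> \<le> 4 * (26 * (B * \<bar>\<kappa> - \<kappa>'\<bar>) * norm x)"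
        using B(3)[OF \<kappa>] by (simp only:) (intro dirichlet_bound integral_abs_lower_order t c continuous_intros; simp)
    qed
    then show ?thesis by simp
  qed
  have "compact_family K \<mu> \<delta> \<epsilon> (2 * M + 208 * B)"
  proof (rule compact_family.intro)
    show "\<mu> > 0" by (fact \<mu>_pos)
    show "2 * M + 208 * B > 0" using M B by simp
    fix \<kappa> \<kappa>' x y assume \<kappa>: "\<kappa> \<in> {\<delta>..\<epsilon>}"
    show "linear (K \<kappa>)" by (rule linear_K)
    show "inner (K \<kappa> x) y = inner x (K \<kappa> y)"
      by (subst (2) inner_commute) (simp add: inner_K Q_sym)
    have "norm (K \<kappa> x) \<le> 2 * (M * norm x)"
      by (intro norm_cfun_le) (use Sb(1)[OF \<kappa>] in \<open>simp add: app_K\<close>)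
    then show "norm (K \<kappa> x) \<le> (2 * M + 208 * B) * norm x"
      using B(1) by (simp add: algebra_simps add_increasing2)
    assume \<kappa>': "\<kappa>' \<in> {\<delta>..\<epsilon>}"
    have "0 \<le> M * \<bar>\<kappa> - \<kappa>'\<bar> * norm x" using M by simp
    with lip[OF \<kappa> \<kappa>', of x] show "norm (K \<kappa> x - K \<kappa>' x) \<le> (2 * M + 208 * B) * \<bar>\<kappa> - \<kappa>'\<bar> * norm x"
      by (simp add: algebra_simps)
  next
    fix l :: "nat \<Rightarrow> real" and X :: "nat \<Rightarrow> cfun"
    assume l: "\<And>n. l n \<in> {\<delta>..\<epsilon>}" and X: "\<And>n. norm (X n) \<le> 1"
    define F where "F n = S (l n) (app (X n))" for n
    have MX: "M * norm (X n) \<le> M" for n using X[of n] M by simp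
    have F1: "norm (F n t) \<le> M" if "t \<in> {-1..1}" for n t
      using Sb(1)[OF l that, of n "X n"] MX[of n] by (simp add: F_def)
    have F2: "norm (F n t - F n u) \<le> M * \<bar>t - u\<bar>" if "t \<in> {-1..1}" "u \<in> {-1..1}" for n t u
      unfolding F_def real_norm_def
      by (rule lipschitz_by_deriv[OF S_deriv _ that])
        (use Sb(2)[OF l] MX order_trans in \<open>blast intro: continuous_intros\<close>)+
    obtain h r where h: "continuous_on {-1..1} h" and r: "strict_mono (r :: nat \<Rightarrow> nat)"
      and conv: "\<And>e. 0 < e \<Longrightarrow> \<exists>N. \<forall>n x. n \<ge> N \<and> x \<in> {-1..1} \<longrightarrow> norm (F (r n) x - h x) < e"
    proof (rule Arzela_Ascoli[of "{-1..1::real}" F M])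
      fix t e :: real assume t: "t \<in> {-1..1}" and e: "e > 0"
      show "\<exists>d>0. \<forall>n y. y \<in> {-1..1} \<and> norm (t - y) < d \<longrightarrow> norm (F n t - F n y) < e"
      proof (intro exI[of _ "e / M"] conjI allI impI)
        fix n y assume y: "y \<in> {-1..1} \<and> norm (t - y) < e / M"
        then have "M * \<bar>t - y\<bar> < e" using M by (simp add: field_simps)
        with F2[OF t, of y n] y show "norm (F n t - F n y) < e" by simp
      qed (use e M in simp)
    qed (use F1 in auto)
    have "(\<lambda>n. K (l (r n)) (X (r n))) \<longlonglongrightarrow> cfun_of h"
    proof (rule LIMSEQ_I)
      fix e :: real assume "e > 0"
      then obtain N where N: "\<And>n x. n \<ge> N \<Longrightarrow> x \<in> {-1..1} \<Longrightarrow> norm (F (r n) x - h x) < e / 4"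
        using conv[of "e / 4"] by auto
      show "\<exists>no. \<forall>n\<ge>no. norm (K (l (r n)) (X (r n)) - cfun_of h) < e"
      proof (intro exI allI impI)
        fix n assume "n \<ge> N"
        then have "norm (K (l (r n)) (X (r n)) - cfun_of h) \<le> 2 * (e / 4)"
          using N[of n] h
          by (intro norm_cfun_le) (auto simp: app_arith app_K F_def intro: less_imp_le)
        with \<open>e > 0\<close> show "norm (K (l (r n)) (X (r n)) - cfun_of h) < e" by simp
      qed
    qed
    with r show "\<exists>r y. strict_mono (r :: nat \<Rightarrow> nat) \<and> (\<lambda>n. K (l (r n)) (X (r n))) \<longlonglongrightarrow> y"
      by blast
  qed
  then show ?thesis by blast
qed


section \<open>The index for fixed and for small \<kappa>\<close>

lemma inner_pencil: "inner x (pencil K \<mu> \<kappa> y) = \<mu> * inner x y + Q \<kappa> x y"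
  by (simp add: pencil_def inner_add_right inner_commute[of x "K \<kappa> y"] inner_K Q_sym)

text \<open>A subspace of dimension \<open>n + 3\<close> contains a nonzero function that vanishes at \<open>n\<close> equidistant
  points and whose derivative vanishes at both end points; the destabilising terms of the form are
  negligible on such functions.\<close>

lemma neg_index_bounded:
  assumes "\<kappa> > 0"
  shows "\<exists>m. \<not> neg_index m (pencil K \<mu> \<kappa>)"
proof -
  obtain R where R: "R > 0" "\<And>x. x \<in> {-1..1} \<Longrightarrow> \<rho> x \<le> R \<and> \<rho>' x \<le> R"
    using \<rho>_bounded by blast
  \<comment> \<open>- G is a lower bound for \<alpha>: only the gravity term of \<alpha> is
    negative.\<close>
  define G where "G = g * k\<^sup>2 / \<kappa> * R"
  have G: "G > 0" using g_pos k_nz assms R(1) by (simp add: G_def)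
  \<comment> \<open>128 = 2 * 8^2, the length of the interval times the square of the constant in
    \<open>ub\<close>. The final estimate needs \<mu> n^2 \<ge> 128 G, and n \<le> n^2.\<close>
  obtain n :: nat where n: "n * \<mu> \<ge> 128 * G"
    using reals_Archimedean3[OF \<mu>_pos] less_imp_le by blast
  have "n > 0" using n G by (cases n) auto
  have n2: "128 * G \<le> \<mu> * (real n)\<^sup>2"
  proof -
    have "real n * 1 \<le> real n * real n" using \<open>n > 0\<close> by (intro mult_left_mono) auto
    then have "real n \<le> (real n)\<^sup>2" by (simp add: power2_eq_square)
    then have "\<mu> * real n \<le> \<mu> * (real n)\<^sup>2" using \<mu>_pos by simp
    with n show ?thesis by (simp add: mult.commute)
  qed
  have "\<not> neg_index (n + 3) (pencil K \<mu> \<kappa>)"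
  proof
    assume "neg_index (n + 3) (pencil K \<mu> \<kappa>)"
    then obtain \<phi> where \<phi>: "\<And>a. \<exists>i<n+3. a i \<noteq> 0 \<Longrightarrow>
        inner (\<Sum>i<n+3. a i *\<^sub>R \<phi> i) (pencil K \<mu> \<kappa> (\<Sum>i<n+3. a i *\<^sub>R \<phi> i)) < 0"
      unfolding neg_index_def by blast
    define p where "p l = -1 + 2 * real l / real n" for l
    \<comment> \<open>Rows below n are point values, row n is the derivative at 1 and row n + 1 the
      one at -1: n + 2 conditions on n + 3 coefficients.\<close>
    define c where "c l i = (if l < n then dirichlet (app (\<phi> i)) (p l)
        else dirichlet_deriv (app (\<phi> i)) (if l = n then 1 else -1))" for l i
    obtain a where a: "\<exists>i<n+3. a i \<noteq> 0" and zero: "\<And>l. l < n + 2 \<Longrightarrow> (\<Sum>i<n+3. a i * c l i) = 0"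
      using homogeneous_system_solution[of "{..<n+3}" "n+2" c] by auto
    define x where "x = (\<Sum>i<n+3. a i *\<^sub>R \<phi> i)"
    have neg: "inner x (pencil K \<mu> \<kappa> x) < 0" using \<phi>[OF a] by (simp add: x_def)
    have p: "p l \<in> {-1..1}" if "l < n" for l
      using that by (auto simp: p_def field_simps)
    have u0: "dirichlet (app x) (p l) = 0" if "l < n" for l
      using zero[of l] that by (simp add: x_def dirichlet_app_sum(2)[OF p[OF that]] c_def)
    have u1: "dirichlet_deriv (app x) 1 = 0" "dirichlet_deriv (app x) (-1) = 0"
      using zero[of n] zero[of "n+1"] by (simp_all add: x_def dirichlet_app_sum(1) c_def)
    have ub: "\<bar>dirichlet (app x) t\<bar> \<le> 8 * norm x / n" if t: "t \<in> {-1..1}" for t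
    proof -
      obtain l where l: "l < n" "\<bar>t - p l\<bar> \<le> 2 / n"
      \<comment> \<open>The nodes are the left ends of n cells; 1 lies in no half-open cell and is
        assigned to the last one.\<close>
      proof (cases "t = 1")
        case True
        then show ?thesis
          using \<open>n > 0\<close> by (intro that[of "n - 1"]) (auto simp: p_def field_simps of_nat_diff)
      next
        case False
        define y where "y = (t + 1) * n / 2"
        have "0 \<le> y" using t by (auto simp: y_def)
        moreover have "(t + 1) * real n < 2 * real n"
          using t False \<open>n > 0\<close> by (intro mult_strict_right_mono) auto
        then have "y < n" by (simp add: y_def)
        ultimately have y: "0 \<le> y" "y < n" by auto
        then have "nat \<lfloor>y\<rfloor> < n" "real (nat \<lfloor>y\<rfloor>) \<le> y" "y \<le> real (nat \<lfloor>y\<rfloor>) + 1"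
          by (auto simp: nat_less_iff floor_less_iff)
        then obtain N where fl: "N < n" "real N \<le> y" "y \<le> real N + 1" by blast
        have "t - p N = (y - real N) * (2 / n)"
          using \<open>n > 0\<close> by (simp add: p_def y_def field_simps)
        also have "\<bar>\<dots>\<bar> \<le> 1 * (2 / n)"
          unfolding abs_mult using fl by (intro mult_mono) auto
        finally show ?thesis using fl by (intro that) auto
      qed
      \<comment> \<open>The slope is at most 4 norm x and a node lies within 2/n, hence the bound 8
        norm x / n.\<close>
      have "\<bar>dirichlet (app x) t - dirichlet (app x) (p l)\<bar> \<le> 4 * norm x * \<bar>t - p l\<bar>"
        by (rule lipschitz_by_deriv[OF dirichlet_deriv dirichlet_deriv_app_bound t p[OF l(1)]]) (auto intro: continuous_intros)
      also have "\<dots> \<le> 4 * norm x * (2 / n)" using l(2) by (intro mult_left_mono) auto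
      finally show ?thesis using u0[OF l(1)] by simp
    qed
    have "- G * (8 * norm x / n)\<^sup>2 * 2 = integral {-1..1::real} (\<lambda>_. - G * (8 * norm x / n)\<^sup>2)"
      by simp
    also have "\<dots> \<le> integral {-1..1} (\<lambda>t. \<alpha> \<kappa> t * (dirichlet (app x) t * dirichlet (app x) t)
        - \<gamma> \<kappa> t * (dirichlet_deriv (app x) t * dirichlet_deriv (app x) t))"
    proof (intro integral_le integrable_continuous_real continuous_intros)
      fix t :: real assume t: "t \<in> {-1..1}"
      have "(dirichlet (app x) t)\<^sup>2 \<le> (8 * norm x / n)\<^sup>2"
        using ub[OF t] by (simp add: abs_le_square_iff[symmetric])
      then have 1: "G * (dirichlet (app x) t)\<^sup>2 \<le> G * (8 * norm x / n)\<^sup>2"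
        using G by simp
      have "g * k\<^sup>2 / \<kappa> * \<rho>' t \<le> G"
        unfolding G_def using g_pos assms R(2)[OF t] by (intro mult_left_mono) auto
      moreover have "k^4 * \<mu> \<ge> 0" "\<kappa> * k\<^sup>2 * \<rho> t \<ge> 0"
        using \<mu>_pos assms \<rho>_pos[OF t] by auto
      ultimately have "- G \<le> \<alpha> \<kappa> t" unfolding \<alpha>_def by linarith
      then have 2: "- G * (dirichlet (app x) t)\<^sup>2 \<le> \<alpha> \<kappa> t * (dirichlet (app x) t)\<^sup>2"
        by (intro mult_right_mono) auto
      have "- \<gamma> \<kappa> t \<ge> 0" using \<mu>_pos assms \<rho>_pos[OF t] by (auto simp: \<gamma>_def)
      then have "0 \<le> - \<gamma> \<kappa> t * (dirichlet_deriv (app x) t)\<^sup>2" by (intro mult_nonneg_nonneg) auto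
      with 1 2 show "- G * (8 * norm x / n)\<^sup>2 \<le> \<alpha> \<kappa> t * (dirichlet (app x) t * dirichlet (app x) t)
          - \<gamma> \<kappa> t * (dirichlet_deriv (app x) t * dirichlet_deriv (app x) t)"
        by (simp add: power2_eq_square[symmetric])
    qed
    also have "\<dots> = Q \<kappa> x x" by (simp add: Q_def u1)
    finally have "inner x (pencil K \<mu> \<kappa> x) \<ge> \<mu> * (norm x)\<^sup>2 - 128 * G * (norm x)\<^sup>2 / n\<^sup>2"
      by (simp add: inner_pencil power2_norm_eq_inner power_divide power_mult_distrib)
    also have "\<mu> * (norm x)\<^sup>2 - 128 * G * (norm x)\<^sup>2 / n\<^sup>2 = (\<mu> - 128 * G / n\<^sup>2) * (norm x)\<^sup>2"
      by (simp add: algebra_simps)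
    finally have "inner x (pencil K \<mu> \<kappa> x) \<ge> (\<mu> - 128 * G / n\<^sup>2) * (norm x)\<^sup>2" by simp
    moreover have "\<mu> - 128 * G / n\<^sup>2 \<ge> 0" using n2 \<open>n > 0\<close> by (simp add: field_simps)
    then have "(\<mu> - 128 * G / n\<^sup>2) * (norm x)\<^sup>2 \<ge> 0" by simp
    ultimately show False using neg by linarith
  qed
  then show ?thesis by blast
qed

end

text \<open>From exponent 2 on, the difference quotient at 0 is at most a positive power of the
  increment; this explains the two successors.\<close>

lemma max0_power_deriv:
  fixes z :: real
  shows "((\<lambda>z. (max 0 z) ^ Suc (Suc n)) has_real_derivative real (Suc (Suc n)) * (max 0 z) ^ Suc n) (at z)"
proof -
  let ?f = "\<lambda>z::real. (max 0 z) ^ Suc (Suc n)"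
  consider "z < 0" | "z = 0" | "z > 0" by linarith
  then show ?thesis
  proof cases
    case 1
    have "((\<lambda>z::real. 0) has_real_derivative real (Suc (Suc n)) * (max 0 z) ^ Suc n) (at z)"
      using 1 by simp
    then show ?thesis
      by (rule has_field_derivative_transform_within_open[of _ _ _ "{..<0}"]) (use 1 in auto)
  next
    case 2
    have "((\<lambda>h. ?f h / h) \<longlongrightarrow> 0) (at 0)"
    proof (rule Lim_null_comparison[of _ "\<lambda>h. \<bar>h\<bar> ^ Suc n"])
      show "\<forall>\<^sub>F h in at 0. norm (?f h / h) \<le> \<bar>h\<bar> ^ Suc n"
        by (rule always_eventually) (auto simp: max_def abs_mult intro!: mult_nonpos_nonneg)
      show "((\<lambda>h::real. \<bar>h\<bar> ^ Suc n) \<longlongrightarrow> 0) (at 0)"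
        by (rule tendsto_eq_intros refl | simp)+
    qed
    then show ?thesis using 2 by (simp add: DERIV_def)
  next
    case 3
    have "((\<lambda>z::real. z ^ Suc (Suc n)) has_real_derivative real (Suc (Suc n)) * (max 0 z) ^ Suc n) (at z)"
      using 3 DERIV_pow[of "Suc (Suc n)" z] by simp
    then show ?thesis
      by (rule has_field_derivative_transform_within_open[of _ _ _ "{0<..}"]) (use 3 in auto)
  qed
qed

context rayleigh_taylor
begin

text \<open>w is the positive part of (t - p)(q - t). Its cube is the lowest power with a continuous
  second derivative across p and q, as an element of \<open>cfun\<close> requires; w v is that
  second derivative. The factor w in all three functions makes disjoint supports evident.\<close>

lemma disjoint_bumps:
  assumes "-1 \<le> p" "p < q" "q \<le> 1"
  obtains x w v where "\<And>t. t \<in> {-1..1} \<Longrightarrow> app x t = w t * v t"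
    "\<And>t. t \<in> {-1..1} \<Longrightarrow> dirichlet (app x) t = (w t)^3"
    "\<And>t. t \<in> {-1..1} \<Longrightarrow> dirichlet_deriv (app x) t = 3 * (w t)\<^sup>2 * (p + q - 2 * t)"
    "\<And>t. w t \<noteq> 0 \<longleftrightarrow> p < t \<and> t < q"
proof -
  define w where "w t = max 0 ((t - p) * (q - t))" for t
  define v where "v t = 6 * (p + q - 2 * t)\<^sup>2 - 6 * w t" for t
  have wc: "continuous_on S w" for S unfolding w_def[abs_def] by (intro continuous_intros)
  have vc: "continuous_on S v" for S unfolding v_def[abs_def] by (intro continuous_intros wc)
  have poly: "((\<lambda>t. (t - p) * (q - t)) has_real_derivative (p + q - 2 * t)) (at t within {-1..1})" for t
    by (auto intro!: derivative_eq_intros)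
  have d1: "((\<lambda>t. (w t)^3) has_real_derivative 3 * (w t)\<^sup>2 * (p + q - 2 * t)) (at t within {-1..1})" for t
    unfolding w_def using DERIV_chain'[OF poly max0_power_deriv[of 1]]
    by (simp add: eval_nat_numeral)
  have "((\<lambda>t. (w t)\<^sup>2) has_real_derivative 2 * w t * (p + q - 2 * t)) (at t within {-1..1})" for t
    unfolding w_def using DERIV_chain'[OF poly max0_power_deriv[of 0]]
    by (simp add: eval_nat_numeral)
  note w2 = this
  have lin: "((\<lambda>t. p + q - 2 * t) has_real_derivative -2) (at t within {-1..1})" for t
    by (auto intro!: derivative_eq_intros)
  have d2: "((\<lambda>t. 3 * (w t)\<^sup>2 * (p + q - 2 * t)) has_real_derivative w t * v t) (at t within {-1..1})" for t
    by (rule DERIV_cong[OF DERIV_mult[OF DERIV_cmult[OF w2] lin]])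
      (simp add: v_def power2_eq_square algebra_simps)
  have c: "continuous_on {-1..1} (\<lambda>t. w t * v t)" by (intro continuous_intros wc vc)
  define x where "x = cfun_of (\<lambda>t. w t * v t)"
  have app: "app x t = w t * v t" if "t \<in> {-1..1}" for t
    unfolding x_def using c that by simp
  have w0: "w t \<noteq> 0 \<longleftrightarrow> p < t \<and> t < q" for t
  proof -
    have "max 0 z \<noteq> 0 \<longleftrightarrow> 0 < z" for z :: real by (auto simp: max_def)
    then have "w t \<noteq> 0 \<longleftrightarrow> 0 < (t - p) * (q - t)" unfolding w_def .
    then show ?thesis using assms by (auto simp: zero_less_mult_iff)
  qed
  have bc: "(w (-1))^3 = 0" "(w 1)^3 = 0" using w0[of "-1"] w0[of 1] assms by auto
  have "dirichlet (app x) t = dirichlet (\<lambda>t. w t * v t) t" "dirichlet_deriv (app x) t = dirichlet_deriv (\<lambda>t. w t * v t) t" if "t \<in> {-1..1}" for t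
    using app that by (intro dirichlet_cong dirichlet_deriv_cong; simp)+
  with dirichlet_unique[OF c d1 d2 bc] show ?thesis
    by (intro that[of x w v] app w0) auto
qed

text \<open>Bumps on m equal cells have disjoint supports, so the form is diagonal on their span,
  and their derivatives vanish at the ends, which removes the slip terms. Each diagonal entry is A +
  \<kappa> B - W / \<kappa> with W > 0, and finitely many entries admit a common small
  \<kappa>.\<close>

lemma neg_index_unbounded:
  assumes "\<epsilon> > 0"
  shows "\<exists>\<delta>\<in>{0<..<\<epsilon>}. neg_index m (pencil K \<mu> \<delta>)"
proof -
  define p where "p i = -1 + 2 * real i / real m" for i
  define bump where "bump i x w v \<longleftrightarrow> (\<forall>t\<in>{-1..1}. app x t = w t * v t) \<and>
      (\<forall>t\<in>{-1..1}. dirichlet (app x) t = (w t)^3) \<and>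
      (\<forall>t\<in>{-1..1}. dirichlet_deriv (app x) t = 3 * (w t)\<^sup>2 * (p i + p (Suc i) - 2 * t)) \<and>
      (\<forall>t. w t \<noteq> 0 \<longleftrightarrow> p i < t \<and> t < p (Suc i))" for i x w and v :: "real \<Rightarrow> real"
  have "\<exists>x w v. bump i x w v" if "i < m" for i
  proof -
    have "-1 \<le> p i" "p i < p (Suc i)" "p (Suc i) \<le> 1"
      using that by (auto simp: p_def field_simps)
    then show ?thesis unfolding bump_def by (rule disjoint_bumps) blast
  qed
  then obtain x w v where bump: "\<And>i. i < m \<Longrightarrow> bump i (x i) (w i) (v i)" by metis
  have x0: "app (x i) t = w i t * v i t"
    and x1: "dirichlet (app (x i)) t = (w i t)^3"
    and x2: "dirichlet_deriv (app (x i)) t = 3 * (w i t)\<^sup>2 * (p i + p (Suc i) - 2 * t)"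
    if "i < m" "t \<in> {-1..1}" for i t
    using bump[OF that(1)] that(2) by (auto simp: bump_def)
  have w: "w i t \<noteq> 0 \<longleftrightarrow> p i < t \<and> t < p (Suc i)" if "i < m" for i t
    using bump[OF that] by (auto simp: bump_def)
  have p_mono: "p i \<le> p j" if "i \<le> j" for i j
    using that by (simp add: p_def divide_right_mono)
  have disj: "w i t * w j t = 0" if "i < m" "j < m" "i \<noteq> j" for i j t
  proof -
    have "p (Suc i) \<le> p j \<or> p (Suc j) \<le> p i" using that p_mono by (meson linorder_neqE_nat Suc_leI)
    then show ?thesis using w[of i t] w[of j t] that by auto
  qed
  have w_end: "w i 1 = 0" "w i (-1) = 0" if "i < m" for i
  proof -
    have "p (Suc i) \<le> 1" "-1 \<le> p i" using that by (auto simp: p_def field_simps)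
    then show "w i 1 = 0" "w i (-1) = 0" using w[OF that, of 1] w[OF that, of "-1"] by auto
  qed
  have off: "inner (x i) (pencil K \<mu> \<kappa> (x j)) = 0" if ij: "i < m" "j < m" "i \<noteq> j" for i j \<kappa>
  proof -
    have "integral {-1..1} (\<lambda>t. app (x i) t * app (x j) t) = integral {-1..1::real} (\<lambda>_. 0)"
      using disj[OF ij] by (intro integral_cong) (auto simp: x0 ij)
    then have 1: "inner (x i) (x j) = 0" by (simp add: inner_cfun_def)
    have "integral {-1..1} (\<lambda>t. \<alpha> \<kappa> t * (dirichlet (app (x i)) t * dirichlet (app (x j)) t)
        - \<gamma> \<kappa> t * (dirichlet_deriv (app (x i)) t * dirichlet_deriv (app (x j)) t)) = integral {-1..1::real} (\<lambda>_. 0)"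
    proof (intro integral_cong)
      fix t :: real assume "t \<in> {-1..1}"
      with disj[OF ij, of t] show "\<alpha> \<kappa> t * (dirichlet (app (x i)) t * dirichlet (app (x j)) t)
        - \<gamma> \<kappa> t * (dirichlet_deriv (app (x i)) t * dirichlet_deriv (app (x j)) t) = 0"
        by (auto simp: x1 x2 ij)
    qed
    then have "Q \<kappa> (x i) (x j) = 0"
      by (simp add: Q_def x2 ij w_end)
    with 1 show ?thesis by (simp add: inner_pencil)
  qed
  have diag: "\<forall>\<^sub>F \<kappa> in at_right 0. inner (x i) (pencil K \<mu> \<kappa> (x i)) < 0" if i: "i < m" for i
  proof -
    define u where "u = dirichlet (app (x i))"
    define u' where "u' = dirichlet_deriv (app (x i))"
    have c[continuous_intros]: "continuous_on {-1..1} u" "continuous_on {-1..1} u'"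
      unfolding u_def u'_def by (intro continuous_intros)+
    define A where "A = \<mu> * inner (x i) (x i)
      + integral {-1..1} (\<lambda>t. k^4 * \<mu> * (u t)\<^sup>2 + 2 * k\<^sup>2 * \<mu> * (u' t)\<^sup>2)"
    define B where "B = integral {-1..1} (\<lambda>t. k\<^sup>2 * \<rho> t * (u t)\<^sup>2 + \<rho> t * (u' t)\<^sup>2)"
    define W where "W = integral {-1..1} (\<lambda>t. g * k\<^sup>2 * \<rho>' t * (u t)\<^sup>2)"
    have "W > 0"
    proof -
      have nn: "0 \<le> g * k\<^sup>2 * \<rho>' t * (u t)\<^sup>2" if "t \<in> {-1..1}" for t
        using \<rho>'_pos[OF that] g_pos by simp
      have "W \<ge> 0" unfolding W_def
        by (intro integral_nonneg integrable_continuous_real continuous_intros nn)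
      moreover have "W \<noteq> 0"
      proof
        assume "W = 0"
        then have *: "\<forall>t\<in>{-1..1}. g * k\<^sup>2 * \<rho>' t * (u t)\<^sup>2 = 0"
          unfolding W_def
          by (subst (asm) integral_eq_0_iff) (auto intro!: continuous_intros nn)
        define t where "t = (p i + p (Suc i)) / 2"
        have pi: "-1 \<le> p i" "p i < p (Suc i)" "p (Suc i) \<le> 1"
          using i by (auto simp: p_def field_simps)
        then have t: "t \<in> {-1..1}" "p i < t" "t < p (Suc i)" by (auto simp: t_def field_simps)
        then have "u t \<noteq> 0" unfolding u_def x1[OF i t(1)] using w[OF i, of t] by simp
        moreover have "g * k\<^sup>2 * \<rho>' t * (u t)\<^sup>2 = 0" using * t(1) by blast
        ultimately show False using \<rho>'_pos[OF t(1)] g_pos k_nz by auto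
      qed
      ultimately show ?thesis by simp
    qed
    have eq: "inner (x i) (pencil K \<mu> \<kappa> (x i)) = A + \<kappa> * B - W / \<kappa>" for \<kappa>
    proof -
      have "integral {-1..1} (\<lambda>t. \<alpha> \<kappa> t * (u t * u t) - \<gamma> \<kappa> t * (u' t * u' t))
        = integral {-1..1} (\<lambda>t. ((k^4 * \<mu> * (u t)\<^sup>2 + 2 * k\<^sup>2 * \<mu> * (u' t)\<^sup>2)
           + \<kappa> * (k\<^sup>2 * \<rho> t * (u t)\<^sup>2 + \<rho> t * (u' t)\<^sup>2)) - 1 / \<kappa> * (g * k\<^sup>2 * \<rho>' t * (u t)\<^sup>2))"
        by (intro integral_cong) (simp add: \<alpha>_def \<gamma>_def power2_eq_square algebra_simps)
      also have "\<dots> = integral {-1..1} (\<lambda>t. k^4 * \<mu> * (u t)\<^sup>2 + 2 * k\<^sup>2 * \<mu> * (u' t)\<^sup>2) + \<kappa> * B - 1 / \<kappa> * W"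
        unfolding B_def W_def integral_mult_right[symmetric]
        by (subst integral_diff, (intro integrable_continuous_real continuous_intros)+,
            subst integral_add, (intro integrable_continuous_real continuous_intros)+) simp
      finally show ?thesis
        by (simp add: inner_pencil Q_def A_def u_def u'_def x2 i w_end)
    qed
    \<comment> \<open>Multiplied by \<kappa> the entry tends to - W, which settles its sign without
      a limit of 1/\<kappa>.\<close>
    have "((\<lambda>\<kappa>. (A + \<kappa> * B) * \<kappa> - W) \<longlongrightarrow> (A + 0 * B) * 0 - W) (at_right 0)"
      by (intro tendsto_intros)
    then have "\<forall>\<^sub>F \<kappa> in at_right 0. (A + \<kappa> * B) * \<kappa> - W < 0"
      using \<open>W > 0\<close> by (intro order_tendstoD(2)) auto
    moreover have "\<forall>\<^sub>F \<kappa> in at_right 0. \<kappa> > (0::real)"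
      by (simp add: eventually_at_right_less)
    ultimately show ?thesis
      by eventually_elim (simp add: eq field_simps)
  qed
  have "\<forall>\<^sub>F \<kappa> in at_right 0. \<forall>i\<in>{..<m}. inner (x i) (pencil K \<mu> \<kappa> (x i)) < 0"
    by (intro eventually_ball_finite) (auto intro: diag)
  moreover have "\<forall>\<^sub>F \<kappa> in at_right 0. \<kappa> \<in> {0<..<\<epsilon>}"
    using eventually_at_right_real[OF assms] .
  ultimately have "\<forall>\<^sub>F \<kappa> in at_right 0. \<kappa> \<in> {0<..<\<epsilon>} \<and> (\<forall>i\<in>{..<m}. inner (x i) (pencil K \<mu> \<kappa> (x i)) < 0)"
    by eventually_elim auto
  then obtain \<delta> where \<delta>: "\<delta> \<in> {0<..<\<epsilon>}" "\<And>i. i < m \<Longrightarrow> inner (x i) (pencil K \<mu> \<delta> (x i)) < 0"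
    using eventually_happens[of _ "at_right (0::real)"] trivial_limit_at_right_real by blast
  have lin: "linear (pencil K \<mu> \<delta>)"
    unfolding pencil_def[abs_def]
    by (intro linear_compose_add linear_compose_scale_right linear_id[unfolded id_def] linear_K)
  have "inner (\<Sum>i<m. a i *\<^sub>R x i) (pencil K \<mu> \<delta> (\<Sum>i<m. a i *\<^sub>R x i)) < 0"
    if a: "\<exists>i<m. a i \<noteq> 0" for a
  proof -
    have "inner (\<Sum>i<m. a i *\<^sub>R x i) (pencil K \<mu> \<delta> (\<Sum>i<m. a i *\<^sub>R x i))
      = (\<Sum>i<m. \<Sum>j<m. a i * a j * inner (x i) (pencil K \<mu> \<delta> (x j)))"
      by (simp add: linear_sum[OF lin] linear_scale[OF lin] inner_sum_left inner_sum_right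
          mult.assoc sum_distrib_left, subst sum.swap) (simp add: mult.left_commute)
    also have "\<dots> = (\<Sum>i<m. (a i)\<^sup>2 * inner (x i) (pencil K \<mu> \<delta> (x i)))"
    proof (intro sum.cong refl)
      fix i assume "i \<in> {..<m}"
      then have "(\<Sum>j<m. a i * a j * inner (x i) (pencil K \<mu> \<delta> (x j)))
          = (\<Sum>j<m. if j = i then (a i)\<^sup>2 * inner (x i) (pencil K \<mu> \<delta> (x i)) else 0)"
        by (intro sum.cong) (auto simp: off power2_eq_square)
      also have "\<dots> = (a i)\<^sup>2 * inner (x i) (pencil K \<mu> \<delta> (x i))"
        using \<open>i \<in> {..<m}\<close> by simp
      finally show "(\<Sum>j<m. a i * a j * inner (x i) (pencil K \<mu> \<delta> (x j))) = \<dots>" .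
    qed
    also have "\<dots> < (\<Sum>i<m. 0)"
    proof (rule sum_strict_mono_ex1)
      show "\<forall>i\<in>{..<m}. (a i)\<^sup>2 * inner (x i) (pencil K \<mu> \<delta> (x i)) \<le> 0"
        using \<delta>(2) by (auto intro!: mult_nonneg_nonpos simp: less_imp_le)
      from a obtain i where "i < m" "a i \<noteq> 0" by blast
      then have "(a i)\<^sup>2 * inner (x i) (pencil K \<mu> \<delta> (x i)) < 0"
        using \<delta>(2)[of i] by (auto intro!: mult_pos_neg)
      with \<open>i < m\<close> show "\<exists>i\<in>{..<m}. (a i)\<^sup>2 * inner (x i) (pencil K \<mu> \<delta> (x i)) < 0" by blast
    qed simp
    finally show ?thesis by simp
  qed
  then have "neg_index m (pencil K \<mu> \<delta>)" unfolding neg_index_def by blast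
  with \<delta>(1) show ?thesis by blast
qed

section \<open>From the change of index to a classical solution\<close>

lemma kernel_exists:
  assumes "\<epsilon> > 0"
  shows "\<exists>\<kappa> x. 0 < \<kappa> \<and> \<kappa> < \<epsilon> \<and> x \<noteq> 0 \<and> pencil K \<mu> \<kappa> x = 0"
proof (rule ccontr)
  assume no: "\<not> ?thesis"
  \<comment> \<open>The order of choice matters: m exceeds the index at \<epsilon> / 2, and \<delta>
    is then taken so small that the index there reaches m. Halving keeps the closed interval below
    \<epsilon>.\<close>
  obtain m where m: "\<not> neg_index m (pencil K \<mu> (\<epsilon> / 2))"
    using neg_index_bounded[of "\<epsilon> / 2"] assms by auto
  obtain \<delta> where \<delta>: "0 < \<delta>" "\<delta> < \<epsilon> / 2" "neg_index m (pencil K \<mu> \<delta>)"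
    using neg_index_unbounded[of "\<epsilon> / 2" m] assms by auto
  obtain C where "compact_family K \<mu> \<delta> (\<epsilon> / 2) C"
    using compact_family_K[OF \<delta>(1)] by blast
  then interpret compact_family K \<mu> \<delta> "\<epsilon> / 2" C .
  have "\<forall>\<kappa>\<in>{\<delta>..\<epsilon> / 2}. \<forall>x. P \<kappa> x = 0 \<longrightarrow> x = 0"
  proof (intro ballI allI impI, rule ccontr)
    fix \<kappa> x assume "\<kappa> \<in> {\<delta>..\<epsilon> / 2}" "P \<kappa> x = 0" "x \<noteq> 0"
    with \<delta> assms have "0 < \<kappa> \<and> \<kappa> < \<epsilon> \<and> x \<noteq> 0 \<and> P \<kappa> x = 0" by auto
    with no show False by blast
  qed
  from neg_index_propagates[OF this _ \<delta>(3)] \<delta>(2) m show False by simp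
qed

lemma classical_solution:
  assumes "\<epsilon> > 0"
  shows "\<exists>\<kappa> u0 u1 u2 u3 u4. 0 < \<kappa> \<and> \<kappa> < \<epsilon> \<and> continuous_on {-1..1} u4 \<and>
    (\<forall>t\<in>{-1..1}. (u0 has_real_derivative u1 t) (at t within {-1..1}) \<and>
      (u1 has_real_derivative u2 t) (at t within {-1..1}) \<and>
      (u2 has_real_derivative u3 t) (at t within {-1..1}) \<and>
      (u3 has_real_derivative u4 t) (at t within {-1..1}) \<and>
      - \<kappa>\<^sup>2 * (\<rho> t * k\<^sup>2 * u0 t - (\<rho>' t * u1 t + \<rho> t * u2 t)) =
        \<kappa> * \<mu> * (u4 t - 2 * k\<^sup>2 * u2 t + k^4 * u0 t) - g * k\<^sup>2 * \<rho>' t * u0 t) \<and>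
    u0 (-1) = 0 \<and> u0 1 = 0 \<and> \<mu> * u2 1 = \<xi>p * u1 1 \<and> \<mu> * u2 (-1) = - \<xi>m * u1 (-1) \<and>
    (\<exists>t\<in>{-1..1}. u0 t \<noteq> 0)"
proof -
  obtain \<kappa> x where \<kappa>: "0 < \<kappa>" "\<kappa> < \<epsilon>" and x: "x \<noteq> 0" "pencil K \<mu> \<kappa> x = 0"
    using kernel_exists[OF assms] by blast
  define h where "h = app x"
  have hc[continuous_intros]: "continuous_on {-1..1} h" by (simp add: h_def continuous_intros)
  \<comment> \<open>On [-1,1] the kernel equation says h = - S h / \<mu>, whose right side is twice
    differentiable: \<open>u2\<close>, \<open>u3\<close>, \<open>u4\<close> are h and its two
    derivatives.\<close>
  define u4 where "u4 t = - lower_order (\<alpha> \<kappa>) (\<beta> \<kappa>) (\<gamma> \<kappa>) h t / \<mu>" for t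
  define u3 where "u3 t = - S' \<kappa> h t / \<mu>" for t
  define u2 where "u2 t = - S \<kappa> h t / \<mu>" for t
  have u2: "u2 t = h t" if "t \<in> {-1..1}" for t
  proof -
    have "app (pencil K \<mu> \<kappa> x) t = \<mu> * h t + S \<kappa> h t"
      using that by (simp add: pencil_def app_arith app_K h_def)
    then show ?thesis
      using x(2) that \<mu>_pos by (simp add: app_arith u2_def field_simps)
  qed
  \<comment> \<open>Multiplying \<mu> \<open>u4\<close> by \<kappa> clears the 1/\<kappa> in
    \<alpha>.\<close>
  have eq: "- \<kappa>\<^sup>2 * (\<rho> t * k\<^sup>2 * dirichlet h t - (\<rho>' t * dirichlet_deriv h t + \<rho> t * u2 t)) =
        \<kappa> * \<mu> * (u4 t - 2 * k\<^sup>2 * u2 t + k^4 * dirichlet h t) - g * k\<^sup>2 * \<rho>' t * dirichlet h t"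
    if "t \<in> {-1..1}" for t
    using \<kappa>(1) \<mu>_pos unfolding u2[OF that] u4_def lower_order_def \<alpha>_def \<beta>_def \<gamma>_def
    by (simp add: field_simps power2_eq_square)
  have nz: "\<exists>t\<in>{-1..1}. dirichlet h t \<noteq> 0"
  proof (rule ccontr)
    assume "\<not> ?thesis"
    then have z: "\<forall>t\<in>{-1..1}. dirichlet h t = 0" by blast
    \<comment> \<open>Uniqueness of derivatives relative to [-1,1], valid at the end points too,
      where they are one-sided.\<close>
    have der0: "d = 0" if "(f has_real_derivative d) (at t within {-1..1})" "\<forall>t\<in>{-1..1}. f t = 0" "t \<in> {-1..1}"
      for f :: "real \<Rightarrow> real" and d t
    proof -
      have "((\<lambda>_. 0) has_real_derivative d) (at t within {-1..1})"
        by (rule has_field_derivative_transform_within[OF that(1) zero_less_one that(3)]) (use that(2) in auto)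
      then show ?thesis
        using vector_derivative_unique_within_closed_interval[of "-1" 1 t "\<lambda>_. 0" d 0] that(3)
        by (auto simp: has_real_derivative_iff_has_vector_derivative)
    qed
    have z1: "dirichlet_deriv h t = 0" if "t \<in> {-1..1}" for t by (rule der0[OF dirichlet_deriv[OF hc that] z that])
    have "h t = 0" if "t \<in> {-1..1}" for t using der0[OF dirichlet_deriv_deriv[OF hc that] _ that] z1 by blast
    then have "x = 0" by (intro cfun_eqI) (simp add: h_def app_arith)
    with x show False by simp
  qed
  have mu2: "\<mu> * u2 1 = \<xi>p * dirichlet_deriv h 1" "\<mu> * u2 (-1) = - \<xi>m * dirichlet_deriv h (-1)"
    using S_boundary[OF hc] \<mu>_pos by (simp_all add: u2_def)
  have c4: "continuous_on {-1..1} u4" unfolding u4_def[abs_def] using \<mu>_pos by (intro continuous_intros) auto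
  have d1: "(dirichlet_deriv h has_real_derivative u2 t) (at t within {-1..1})" if "t \<in> {-1..1}" for t
    using dirichlet_deriv_deriv[OF hc that] u2[OF that] by simp
  have d2: "(u2 has_real_derivative u3 t) (at t within {-1..1})" if "t \<in> {-1..1}" for t
    unfolding u2_def[abs_def] u3_def by (intro derivative_intros DERIV_cdivide S_deriv hc that)
  have d3: "(u3 has_real_derivative u4 t) (at t within {-1..1})" if "t \<in> {-1..1}" for t
    unfolding u3_def[abs_def] u4_def by (intro derivative_intros DERIV_cdivide S'_deriv hc that)
  show ?thesis
    by (rule exI[of _ \<kappa>], rule exI[of _ "dirichlet h"], rule exI[of _ "dirichlet_deriv h"], rule exI[of _ u2],
        rule exI[of _ u3], rule exI[of _ u4])
      (use \<kappa> c4 dirichlet_deriv[OF hc] d1 d2 d3 eq dirichlet_left dirichlet_right[OF hc] mu2 nz in blast)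
qed

end

section \<open>Weak derivatives\<close>

subsection \<open>Bump functions\<close>

text \<open>All derivatives of the standard cutoff exp(-1/x), which is \<open>flat 1\<close>, are of
  this form.\<close>

definition flat :: "real poly \<Rightarrow> real \<Rightarrow> real" where
  "flat p x = (if x \<le> 0 then 0 else poly p (1 / x) * exp (- (1 / x)))"

lemma poly_times_exp_minus_tendsto: "((\<lambda>y. poly p y * exp (- y)) \<longlongrightarrow> 0) (at_top :: real filter)"
proof -
  have "((\<lambda>y. \<Sum>i\<le>degree p. coeff p i * (y ^ i / exp y)) \<longlongrightarrow> (\<Sum>i\<le>degree p. coeff p i * 0)) at_top"
    by (intro tendsto_intros tendsto_power_div_exp_0)
  then show ?thesis
    by (simp add: poly_altdef sum_distrib_right sum_divide_distrib exp_minus field_simps)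
qed

text \<open>With y = 1/x, differentiation turns p(y) exp(-y) into y^2 (p(y) - p'(y)) exp(-y). At 0
  the right difference quotient is y p(y) exp(-y) with y tending to infinity.\<close>

lemma flat_deriv: "(flat p has_real_derivative flat ([:0, 0, 1:] * (p - pderiv p)) x) (at x)"
proof -
  let ?q = "[:0, 0, 1:] * (p - pderiv p)"
  consider "x < 0" | "x = 0" | "x > 0" by linarith
  then show ?thesis
  proof cases
    case 1
    have "((\<lambda>_. 0) has_real_derivative flat ?q x) (at x)" using 1 by (simp add: flat_def)
    then show ?thesis
      by (rule has_field_derivative_transform_within_open[of _ _ _ "{..<0}"]) (use 1 in \<open>auto simp: flat_def\<close>)
  next
    case 2
    have r: "((\<lambda>h. flat p h / h) \<longlongrightarrow> 0) (at_right 0)"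
    proof -
      have "((\<lambda>h. poly ([:0, 1:] * p) (inverse h) * exp (- inverse h)) \<longlongrightarrow> 0) (at_right (0::real))"
        by (rule filterlim_compose[OF poly_times_exp_minus_tendsto filterlim_inverse_at_top_right])
      moreover have "\<forall>\<^sub>F h in at_right 0. h > (0::real)" by (simp add: eventually_at_right_less)
      then have "\<forall>\<^sub>F h in at_right 0. poly ([:0, 1:] * p) (inverse h) * exp (- inverse h) = flat p h / h"
        by eventually_elim (simp add: flat_def field_simps)
      ultimately show ?thesis by (rule Lim_transform_eventually)
    qed
    have l: "((\<lambda>h. flat p h / h) \<longlongrightarrow> 0) (at_left 0)"
    proof (rule Lim_transform_eventually[OF tendsto_const])
      have "\<forall>\<^sub>F h in at_left 0. h < (0::real)" by (simp add: eventually_at_filter)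
      then show "\<forall>\<^sub>F h in at_left 0. 0 = flat p h / h"
        by eventually_elim (simp add: flat_def)
    qed
    from l r have "((\<lambda>h. flat p h / h) \<longlongrightarrow> 0) (at 0)" by (simp add: filterlim_split_at)
    then show ?thesis using 2 by (simp add: DERIV_def flat_def)
  next
    case 3
    have "((\<lambda>x. poly p (1 / x) * exp (- (1 / x))) has_real_derivative flat ?q x) (at x)"
      using 3 by (auto intro!: derivative_eq_intros simp: flat_def power2_eq_square field_simps)
    then show ?thesis
      by (rule has_field_derivative_transform_within_open[of _ _ _ "{0<..}"]) (use 3 in \<open>auto simp: flat_def\<close>)
  qed
qed

text \<open>A class closed under differentiation, so that smoothness of every order is a plain
  induction: the inner factor r is absorbed into p, and the product rule needs sums. Negative r
  serves the decreasing factor of a bump.\<close>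

inductive_set flat_algebra :: "(real \<Rightarrow> real) set" where
  base: "(\<lambda>x. flat p (r * x + s)) \<in> flat_algebra"
| add: "f \<in> flat_algebra \<Longrightarrow> g \<in> flat_algebra \<Longrightarrow> (\<lambda>x. f x + g x) \<in> flat_algebra"
| mult: "f \<in> flat_algebra \<Longrightarrow> g \<in> flat_algebra \<Longrightarrow> (\<lambda>x. f x * g x) \<in> flat_algebra"

lemma flat_smult: "flat (smult c p) x = c * flat p x"
  by (simp add: flat_def)

lemma flat_algebra_deriv:
  assumes "f \<in> flat_algebra"
  shows "\<exists>f'\<in>flat_algebra. \<forall>x. (f has_real_derivative f' x) (at x)"
  using assms
proof induction
  case (base p r s)
  let ?q = "smult r ([:0, 0, 1:] * (p - pderiv p))"
  have "((\<lambda>x. flat p (r * x + s)) has_real_derivative flat ?q (r * x + s)) (at x)" for x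
  proof -
    have "((\<lambda>x. r * x + s) has_real_derivative r) (at x)" by (auto intro!: derivative_eq_intros)
    from DERIV_chain'[OF this flat_deriv] show ?thesis unfolding flat_smult by (simp add: mult.commute)
  qed
  then show ?case
    by (intro bexI[OF _ flat_algebra.base[of ?q r s]] allI)
next
  case (add f g)
  then obtain f' g' where "f' \<in> flat_algebra" "g' \<in> flat_algebra"
    "\<forall>x. (f has_real_derivative f' x) (at x)" "\<forall>x. (g has_real_derivative g' x) (at x)" by blast
  then show ?case
    by (intro bexI[of _ "\<lambda>x. f' x + g' x"] flat_algebra.add) (auto intro!: derivative_intros)
next
  case (mult f g)
  then obtain f' g' where "f' \<in> flat_algebra" "g' \<in> flat_algebra"
    "\<forall>x. (f has_real_derivative f' x) (at x)" "\<forall>x. (g has_real_derivative g' x) (at x)" by blast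
  with mult.hyps show ?case
    by (intro bexI[of _ "\<lambda>x. f' x * g x + g' x * f x"] flat_algebra.add flat_algebra.mult)
      (auto intro!: DERIV_mult)
qed

lemma flat_algebra_smooth:
  assumes "f \<in> flat_algebra"
  shows "((deriv ^^ n) f) field_differentiable (at x)"
proof -
  have "(deriv ^^ n) f \<in> flat_algebra"
  proof (induction n)
    case (Suc n)
    then obtain f' where f': "f' \<in> flat_algebra" "\<forall>x. ((deriv ^^ n) f has_real_derivative f' x) (at x)"
      using flat_algebra_deriv by blast
    then have "deriv ((deriv ^^ n) f) = f'" by (auto intro!: ext DERIV_imp_deriv)
    with f' show ?case by simp
  qed (use assms in simp)
  then show ?thesis using flat_algebra_deriv field_differentiable_def by blast
qed

text \<open>The support stays fixed while the values inside increase to 1 with n; dominated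
  convergence then takes the place of mollification.\<close>

definition bump :: "real \<Rightarrow> real \<Rightarrow> nat \<Rightarrow> real \<Rightarrow> real" where
  "bump c d n x = flat 1 (real (Suc n) * (x - c)) * flat 1 (real (Suc n) * (d - x))"

lemma bump_smooth: "((deriv ^^ j) (bump c d n)) field_differentiable (at x)"
proof (rule flat_algebra_smooth)
  have "bump c d n = (\<lambda>x. flat 1 (real (Suc n) * x + (- real (Suc n) * c)) * flat 1 (- real (Suc n) * x + real (Suc n) * d))"
    by (simp add: bump_def fun_eq_iff algebra_simps)
  then show "bump c d n \<in> flat_algebra"
    using flat_algebra.mult flat_algebra.base by simp
qed

lemma bump_zero: "x \<notin> {c<..<d} \<Longrightarrow> bump c d n x = 0"
  by (auto simp: bump_def flat_def mult_nonneg_nonpos not_less)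

lemma bump_bounds: "0 \<le> bump c d n x" "bump c d n x \<le> 1"
  by (auto simp: bump_def flat_def intro!: mult_nonneg_nonneg mult_le_one)

lemma bump_tendsto: "(\<lambda>n. bump c d n x) \<longlonglongrightarrow> indicator {c<..<d} x"
proof (cases "x \<in> {c<..<d}")
  case True
  have lim: "(\<lambda>n. exp (- (1 / (real (Suc n) * y)))) \<longlonglongrightarrow> 1" for y
  proof -
    have "(\<lambda>n. exp (- (1 / real (Suc n) * (1 / y)))) \<longlonglongrightarrow> exp (- (0 * (1 / y)))"
      by (intro tendsto_intros LIMSEQ_Suc[OF lim_1_over_n])
    then show ?thesis by (simp add: field_simps)
  qed
  have "(\<lambda>n. exp (- (1 / (real (Suc n) * (x - c)))) * exp (- (1 / (real (Suc n) * (d - x))))) \<longlonglongrightarrow> 1 * 1"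
    by (intro tendsto_mult lim)
  then show ?thesis using True by (simp add: bump_def flat_def mult_le_0_iff)
qed (simp add: bump_zero)

lemma test_function_bump:
  assumes "a < c" "d < b"
  shows "test_function a b (bump c d n)"
proof -
  have sub: "{x. bump c d n x \<noteq> 0} \<subseteq> {c..d}"
  proof
    fix x assume "x \<in> {x. bump c d n x \<noteq> 0}"
    then show "x \<in> {c..d}" using bump_zero[of x c d n] by (cases "x \<in> {c<..<d}") auto
  qed
  then have "closure {x. bump c d n x \<noteq> 0} \<subseteq> {c..d}" by (rule closure_minimal) simp
  moreover have "compact (closure {x. bump c d n x \<noteq> 0})"
    unfolding compact_closure by (rule bounded_subset[OF bounded_closed_interval sub])
  ultimately show ?thesis
    using assms bump_smooth[of _ c d n] unfolding test_function_def by auto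
qed

subsection \<open>The fundamental lemma of the calculus of variations\<close>

text \<open>The measures whose densities are the positive and negative part of g are finite and
  equal on rays, hence equal; densities are unique almost everywhere, and both parts can only agree
  where g = 0.\<close>

lemma AE_zero_if_tail_integrals_zero_lborel:
  fixes g :: "real \<Rightarrow> real"
  assumes g: "integrable lborel g" and z: "\<And>x. (LINT t|lborel. indicator {x<..} t * g t) = 0"
  shows "AE t in lborel. g t = 0"
proof -
  have [measurable]: "g \<in> borel_measurable borel" using g by simp
  have int: "integrable lborel (\<lambda>t. indicator {x<..} t * g t)" for x
    using integrable_mult_indicator[OF _ g, of "{x<..}"] by simp
  have em: "emeasure (density lborel (\<lambda>t. ennreal (s * g t))) {x<..} = (\<integral>\<^sup>+ t. ennreal (s * (indicator {x<..} t * g t)) \<partial>lborel)"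
    for s x by (subst emeasure_density) (auto intro!: nn_integral_cong simp: indicator_def)
  have fin: "(\<integral>\<^sup>+ t. ennreal (indicator {x<..} t * g t) \<partial>lborel) < \<infinity>"
    "(\<integral>\<^sup>+ t. ennreal (- (indicator {x<..} t * g t)) \<partial>lborel) < \<infinity>" for x
    using int[of x] by (auto simp: real_integrable_def top.not_eq_extremum)
  \<comment> \<open>\<open>ennreal\<close> sends negative numbers to 0, so these densities are the
    positive and the negative part.\<close>
  have "density lborel (\<lambda>t. ennreal (1 * g t)) = density lborel (\<lambda>t. ennreal (-1 * g t))"
  proof (rule measure_eqI_lessThan)
    fix x
    show "emeasure (density lborel (\<lambda>t. ennreal (1 * g t))) {x<..} < \<infinity>"
      unfolding em using fin(1) by simp
    define p where "p = (\<integral>\<^sup>+ t. ennreal (indicator {x<..} t * g t) \<partial>lborel)"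
    define q where "q = (\<integral>\<^sup>+ t. ennreal (- (indicator {x<..} t * g t)) \<partial>lborel)"
    have "enn2real p = enn2real q"
      using real_lebesgue_integral_def[OF int[of x]] z[of x] by (simp add: p_def q_def)
    moreover have "p = ennreal (enn2real p)" "q = ennreal (enn2real q)"
      using fin[of x, folded p_def q_def] by simp_all
    ultimately have "p = q" by (simp only:)
    then show "emeasure (density lborel (\<lambda>t. ennreal (1 * g t))) {x<..}
        = emeasure (density lborel (\<lambda>t. ennreal (-1 * g t))) {x<..}"
      unfolding em by (simp add: p_def q_def)
  qed auto
  then have "AE t in lborel. ennreal (1 * g t) = ennreal (-1 * g t)"
    by (intro sigma_finite_measure.density_unique[OF sigma_finite_lborel]) auto
  then show ?thesis
  proof eventually_elim
    case (elim t)
    then show ?case by (cases "0 \<le> g t") (simp_all add: ennreal_neg)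
  qed
qed

text \<open>Reduction to the Borel case through a Borel representative.\<close>

lemma AE_zero_if_tail_integrals_zero:
  fixes f :: "real \<Rightarrow> real"
  assumes f: "integrable lebesgue f" and z: "\<And>x. (LINT t|lebesgue. indicator {x<..} t * f t) = 0"
  shows "AE t in lebesgue. f t = 0"
proof -
  have fm: "f \<in> borel_measurable (completion lborel)" using f by simp
  obtain g where g[measurable]: "g \<in> borel_measurable lborel" and eq: "AE t in lborel. f t = g t"
    using completion_ex_borel_measurable_real[OF fm] by blast
  have eq': "AE t in lebesgue. f t = g t" using eq by (rule AE_completion)
  have gm: "g \<in> borel_measurable lebesgue" by (rule measurable_completion[OF g])
  have "integrable lebesgue g" using integrable_cong_AE_imp[OF f gm] eq' by simp
  then have "integrable lborel g" using integrable_completion[OF g] by simp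
  moreover have "(LINT t|lborel. indicator {x<..} t * g t) = 0" for x
  proof -
    have m: "(\<lambda>t. indicator {x<..} t * g t) \<in> borel_measurable lborel" by measurable
    have "(LINT t|lborel. indicator {x<..} t * g t) = (LINT t|lebesgue. indicator {x<..} t * g t)"
      by (rule integral_completion[OF m, symmetric])
    also have "\<dots> = (LINT t|lebesgue. indicator {x<..} t * f t)"
    proof (rule integral_cong_AE)
      show "(\<lambda>t. indicator {x<..} t * g t) \<in> borel_measurable lebesgue" by (rule measurable_completion[OF m])
      show "(\<lambda>t. indicator {x<..} t * f t) \<in> borel_measurable lebesgue"
        using f by (intro borel_measurable_times borel_measurable_indicator) auto
      show "AE t in lebesgue. indicator {x<..} t * g t = indicator {x<..} t * f t"
        using eq' by eventually_elim simp
    qed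
    finally show ?thesis using z by simp
  qed
  ultimately have "AE t in lborel. g t = 0" by (rule AE_zero_if_tail_integrals_zero_lborel)
  then have "AE t in lebesgue. g t = 0" by (rule AE_completion)
  with eq' show ?thesis by eventually_elim simp
qed

lemma LINT_lebesgue_on: "S \<in> sets lebesgue \<Longrightarrow> (LINT x|lebesgue_on S. f x) = (LINT x|lebesgue. indicator S x * f x)"
  for f :: "real \<Rightarrow> real"
  by (subst integral_restrict_space) auto

lemma integrable_lebesgue_on: "S \<in> sets lebesgue \<Longrightarrow> integrable (lebesgue_on S) f \<longleftrightarrow> integrable lebesgue (\<lambda>x. indicator S x * f x)"
  for f :: "real \<Rightarrow> real"
  by (subst integrable_restrict_space) (auto simp: mult.commute)

lemma AE_lebesgue_on: "S \<in> sets lebesgue \<Longrightarrow> (AE x in lebesgue_on S. P x) \<longleftrightarrow> (AE x in lebesgue. x \<in> S \<longrightarrow> P x)"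
  by (subst AE_restrict_space_iff) auto

text \<open>Bumps that fill an open interval show in the limit that f integrates to 0 over it; so
  all tail integrals of f cut off to [c,d] vanish.\<close>

lemma fundamental_lemma:
  assumes f: "locally_integrable a b f"
    and z: "\<And>\<psi>. test_function a b \<psi> \<Longrightarrow> (LINT x|lebesgue_on {a<..<b}. f x * \<psi> x) = 0"
  shows "AE x in lebesgue_on {a<..<b}. f x = 0"
proof -
  have local: "AE x in lebesgue. x \<in> {c..d} \<longrightarrow> f x = 0" if cd: "a < c" "d < b" for c d
  proof -
    define h where "h x = indicator {c..d} x * f x" for x
    have h: "integrable lebesgue h"
      using f cd by (auto simp: locally_integrable_def set_integrable_def h_def[abs_def])
    have "(LINT t|lebesgue. indicator {x<..} t * h t) = 0" for x
    proof -
      \<comment> \<open>Up to end points, the ray beyond x meets [c,d] in the interval from c' to d,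
        which is empty for x \<ge> d.\<close>
      define c' where "c' = max x c"
      have c': "a < c'" using cd by (simp add: c'_def)
      have "(\<lambda>n. LINT t|lebesgue. bump c' d n t * h t) \<longlonglongrightarrow> (LINT t|lebesgue. indicator {c'<..<d} t * h t)"
      proof (rule integral_dominated_convergence[where w = "\<lambda>t. \<bar>h t\<bar>"])
        show "(\<lambda>t. indicator {c'<..<d} t * h t) \<in> borel_measurable lebesgue"
          using h by (intro borel_measurable_times borel_measurable_indicator) auto
        have "continuous_on UNIV (bump c' d n)" for n
          using bump_smooth[of 0 c' d n] by (simp add: field_differentiable_imp_continuous_at continuous_at_imp_continuous_on)
        then have "bump c' d n \<in> borel_measurable lebesgue" for n
          by (intro measurable_completion) (simp add: borel_measurable_continuous_onI)
        then show "(\<lambda>t. bump c' d n t * h t) \<in> borel_measurable lebesgue" for n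
          using h by (intro borel_measurable_times) auto
        show "AE t in lebesgue. (\<lambda>n. bump c' d n t * h t) \<longlonglongrightarrow> indicator {c'<..<d} t * h t"
          by (intro AE_I2 tendsto_mult bump_tendsto tendsto_const)
        show "AE t in lebesgue. norm (bump c' d n t * h t) \<le> \<bar>h t\<bar>" for n
          using bump_bounds[of c' d n] by (intro AE_I2) (auto simp: abs_mult intro!: mult_left_le_one_le)
      qed (use h in auto)
      moreover have "(LINT t|lebesgue. bump c' d n t * h t) = 0" for n
      proof -
        have "(LINT t|lebesgue. bump c' d n t * h t) = (LINT t|lebesgue. indicator {a<..<b} t * (f t * bump c' d n t))"
        proof (rule Bochner_Integration.integral_cong[OF refl])
          fix t
          show "bump c' d n t * h t = indicator {a<..<b} t * (f t * bump c' d n t)"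
            using bump_zero[of t c' d n] cd by (cases "t \<in> {c'<..<d}") (auto simp: h_def c'_def)
        qed
        also have "\<dots> = (LINT t|lebesgue_on {a<..<b}. f t * bump c' d n t)"
          by (rule LINT_lebesgue_on[symmetric]) simp
        also have "\<dots> = 0" by (intro z test_function_bump c' cd)
        finally show ?thesis .
      qed
      ultimately have "(LINT t|lebesgue. indicator {c'<..<d} t * h t) = 0"
        by (simp add: LIMSEQ_const_iff)
      moreover have "(LINT t|lebesgue. indicator {x<..} t * h t) = (LINT t|lebesgue. indicator {c'<..<d} t * h t)"
      proof (rule integral_cong_AE)
        have "AE t in lebesgue. t \<notin> {c, d}"
          by (rule AE_not_in, rule null_sets_completionI) (auto intro: countable_imp_null_set_lborel)
        then show "AE t in lebesgue. indicator {x<..} t * h t = indicator {c'<..<d} t * h t"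
          by eventually_elim (auto simp: h_def c'_def indicator_def)
      qed (use h in \<open>intro borel_measurable_times borel_measurable_indicator; auto\<close>)+
      ultimately show ?thesis by simp
    qed
    then have "AE t in lebesgue. h t = 0" by (rule AE_zero_if_tail_integrals_zero[OF h])
    then show ?thesis by eventually_elim (auto simp: h_def)
  qed
  \<comment> \<open>Countably many closed subintervals exhaust the open interval.\<close>
  have "AE x in lebesgue. \<forall>n. x \<in> {a + inverse (real (Suc n))..b - inverse (real (Suc n))} \<longrightarrow> f x = 0"
    unfolding AE_all_countable by (intro allI local) auto
  then have "AE x in lebesgue. x \<in> {a<..<b} \<longrightarrow> f x = 0"
  proof eventually_elim
    case (elim x)
    show ?case
    proof
      assume "x \<in> {a<..<b}"
      then obtain n where "inverse (real (Suc n)) < min (x - a) (b - x)"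
        using reals_Archimedean[of "min (x - a) (b - x)"] by auto
      then show "f x = 0" using elim[rule_format, of n] by auto
    qed
  qed
  then show ?thesis by (simp add: AE_lebesgue_on)
qed

subsection \<open>Weak derivatives of classically differentiable functions\<close>

lemma
  fixes f :: "real \<Rightarrow> real"
  assumes "continuous_on {a..b} f"
  shows integrable_lebesgue_on_Ioo: "integrable (lebesgue_on {a<..<b}) f"
    and LINT_Ioo: "(LINT x|lebesgue_on {a<..<b}. f x) = integral {a..b} f"
proof -
  have "f absolutely_integrable_on {a..b}"
    by (rule absolutely_integrable_continuous_real[OF assms])
  then have "f absolutely_integrable_on {a<..<b}"
    by (rule set_integrable_subset) auto
  then show i: "integrable (lebesgue_on {a<..<b}) f"
    by (simp add: integrable_lebesgue_on set_integrable_def)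
  show "(LINT x|lebesgue_on {a<..<b}. f x) = integral {a..b} f"
    using lebesgue_integral_eq_integral[OF i] integral_open_interval_real[of a b f] by simp
qed

lemma continuous_AE_zero:
  fixes f :: "real \<Rightarrow> real"
  assumes "a < b" and f: "continuous_on {a..b} f" and ae: "AE x in lebesgue_on {a<..<b}. f x = 0"
    and x: "x \<in> {a..b}"
  shows "f x = 0"
proof -
  have c: "continuous_on {a..b} (\<lambda>x. (f x)\<^sup>2)" by (intro continuous_intros f)
  have "(LINT x|lebesgue_on {a<..<b}. (f x)\<^sup>2) = 0"
    using ae by (intro integral_eq_zero_AE) auto
  then have "integral {a..b} (\<lambda>x. (f x)\<^sup>2) = 0" by (simp add: LINT_Ioo[OF c])
  then have "\<forall>x\<in>{a..b}. (f x)\<^sup>2 = 0"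
    using \<open>a < b\<close> c by (subst (asm) integral_eq_0_iff) auto
  then show ?thesis using x by simp
qed

text \<open>Two continuous representatives agree almost everywhere, hence on the whole closed
  interval; this is the uniqueness that the definite description demands.\<close>

lemma cont_value_eq:
  assumes "a < b" and h: "continuous_on {a..b} h" and ae: "AE t in lebesgue_on {a<..<b}. f t = h t"
    and x: "x \<in> {a..b}"
  shows "cont_value a b f x = h x"
  unfolding cont_value_def
proof (rule the_equality)
  show "\<exists>h'. continuous_on {a..b} h' \<and> (AE t in lebesgue_on {a<..<b}. f t = h' t) \<and> h' x = h x"
    using h ae by blast
next
  fix y assume "\<exists>h'. continuous_on {a..b} h' \<and> (AE t in lebesgue_on {a<..<b}. f t = h' t) \<and> h' x = y"
  then obtain h' where h': "continuous_on {a..b} h'" "AE t in lebesgue_on {a<..<b}. f t = h' t" "h' x = y"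
    by blast
  have "AE t in lebesgue_on {a<..<b}. h' t - h t = 0"
    using h'(2) ae by eventually_elim simp
  moreover have "continuous_on {a..b} (\<lambda>t. h' t - h t)" by (intro continuous_intros h h'(1))
  ultimately have "h' x - h x = 0" using continuous_AE_zero[OF \<open>a < b\<close> _ _ x] by blast
  with h'(3) show "y = h x" by simp
qed

lemma continuous_L2:
  assumes f: "continuous_on {a..b} f"
  shows "f \<in> L2 a b"
  unfolding L2_def using integrable_lebesgue_on_Ioo[OF f]
    integrable_lebesgue_on_Ioo[of a b "\<lambda>x. (f x)\<^sup>2"] f
  by (auto intro: continuous_intros)

lemma continuous_locally_integrable:
  assumes f: "continuous_on {a..b} f"
  shows "locally_integrable a b f"
  unfolding locally_integrable_def
proof (intro allI impI)
  fix c d assume "a < c \<and> d < b"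
  then show "f absolutely_integrable_on {c..d}"
    by (intro absolutely_integrable_continuous_real continuous_on_subset[OF f]) auto
qed

section \<open>Test functions and uniqueness of weak derivatives\<close>

lemma test_function_support:
  assumes "test_function a b \<psi>"
  obtains c d where "a < c" "d < b" "\<And>x. x \<notin> {c..d} \<Longrightarrow> \<psi> x = 0"
proof (cases "{x. \<psi> x \<noteq> 0} = {}")
  case True
  then show ?thesis by (intro that[of "a + 1" "b - 1"]) auto
next
  case False
  let ?K = "closure {x. \<psi> x \<noteq> 0}"
  have K: "compact ?K" "?K \<subseteq> {a<..<b}" "?K \<noteq> {}"
    using assms False by (auto simp: test_function_def)
  obtain c d where cd: "c \<in> ?K" "d \<in> ?K" "\<And>x. x \<in> ?K \<Longrightarrow> c \<le> x \<and> x \<le> d"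
    using compact_attains_inf[OF K(1,3)] compact_attains_sup[OF K(1,3)] by metis
  show ?thesis
  proof (rule that[of c d])
    show "a < c" "d < b" using cd K(2) by auto
    fix x assume "x \<notin> {c..d}"
    then have "x \<notin> ?K" using cd(3)[of x] by auto
    then show "\<psi> x = 0" using closure_subset[of "{x. \<psi> x \<noteq> 0}"] by auto
  qed
qed

lemma test_function_continuous: "test_function a b \<psi> \<Longrightarrow> continuous_on S \<psi>"
  unfolding test_function_def
  by (metis continuous_at_imp_continuous_on field_differentiable_imp_continuous_at funpow_0)

lemma test_function_has_deriv: "test_function a b \<psi> \<Longrightarrow> (\<psi> has_real_derivative deriv \<psi> x) (at x)"
  unfolding test_function_def by (metis field_differentiable_derivI funpow_0)

lemma test_function_deriv:
  assumes "test_function a b \<psi>"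
  shows "test_function a b (deriv \<psi>)"
proof -
  let ?K = "closure {x. \<psi> x \<noteq> 0}"
  have "deriv \<psi> x = 0" if "x \<notin> ?K" for x
  proof -
    have "((\<lambda>_. 0) has_real_derivative 0) (at x)" by simp
    then have "(\<psi> has_real_derivative 0) (at x)"
      by (rule has_field_derivative_transform_within_open[of _ _ _ "- ?K"])
        (use that closure_subset[of "{x. \<psi> x \<noteq> 0}"] in auto)
    then show ?thesis by (rule DERIV_imp_deriv)
  qed
  then have "closure {x. deriv \<psi> x \<noteq> 0} \<subseteq> ?K" by (intro closure_minimal) auto
  moreover from this assms have "compact (closure {x. deriv \<psi> x \<noteq> 0})"
    unfolding test_function_def by (metis closed_closure compact_Int_closed inf.absorb_iff2)
  moreover have "((deriv ^^ n) (deriv \<psi>)) field_differentiable (at x)" for n x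
    using assms unfolding test_function_def by (metis comp_apply funpow_Suc_right)
  ultimately show ?thesis using assms unfolding test_function_def by blast
qed

lemma test_function_deriv_funpow: "test_function a b \<psi> \<Longrightarrow> test_function a b ((deriv ^^ n) \<psi>)"
  by (induction n) (auto intro: test_function_deriv)

text \<open>f may fail to be integrable up to the ends; the support of \<psi> confines the product
  to a compact subinterval.\<close>

lemma integrable_times_test_function:
  assumes f: "locally_integrable a b f" and \<psi>: "test_function a b \<psi>"
  shows "integrable (lebesgue_on {a<..<b}) (\<lambda>x. f x * \<psi> x)"
proof -
  obtain c d where cd: "a < c" "d < b" "\<And>x. x \<notin> {c..d} \<Longrightarrow> \<psi> x = 0"
    using test_function_support[OF \<psi>] by blast
  have c: "continuous_on {c..d} \<psi>" by (rule test_function_continuous[OF \<psi>])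
  have "(\<lambda>x. \<psi> x * f x) absolutely_integrable_on {c..d}"
  proof (rule absolutely_integrable_bounded_measurable_product_real)
    show "\<psi> \<in> borel_measurable (lebesgue_on {c..d})"
      using c by (intro continuous_imp_measurable_on_sets_lebesgue) auto
    show "bounded (\<psi> ` {c..d})"
      using c by (intro compact_imp_bounded compact_continuous_image) auto
    show "f absolutely_integrable_on {c..d}" using f cd by (simp add: locally_integrable_def)
  qed simp
  moreover have "indicator {c..d} x * (\<psi> x * f x) = indicator {a<..<b} x * (f x * \<psi> x)" for x
    using cd by (cases "x \<in> {c..d}") auto
  ultimately show ?thesis by (simp add: integrable_lebesgue_on set_integrable_def)
qed

lemma weak_deriv_AE_unique:
  assumes "is_weak_deriv a b j f h" "is_weak_deriv a b j f h'"
  shows "AE x in lebesgue_on {a<..<b}. h x = h' x"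
proof -
  have li: "locally_integrable a b h" "locally_integrable a b h'"
    using assms by (auto simp: is_weak_deriv_def)
  have "AE x in lebesgue_on {a<..<b}. h x - h' x = 0"
  proof (rule fundamental_lemma)
    show "locally_integrable a b (\<lambda>x. h x - h' x)"
      using li by (auto simp: locally_integrable_def)
    fix \<psi> assume \<psi>: "test_function a b \<psi>"
    have "(-1) ^ j * (LINT x|lebesgue_on {a<..<b}. h x * \<psi> x) = (-1) ^ j * (LINT x|lebesgue_on {a<..<b}. h' x * \<psi> x)"
    proof -
      have "(LINT x|lebesgue_on {a<..<b}. f x * (deriv ^^ j) \<psi> x) = (-1) ^ j * (LINT x|lebesgue_on {a<..<b}. h x * \<psi> x)"
        using assms(1) \<psi> by (simp add: is_weak_deriv_def)
      moreover have "(LINT x|lebesgue_on {a<..<b}. f x * (deriv ^^ j) \<psi> x) = (-1) ^ j * (LINT x|lebesgue_on {a<..<b}. h' x * \<psi> x)"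
        using assms(2) \<psi> by (simp add: is_weak_deriv_def)
      ultimately show ?thesis by (rule trans[OF sym])
    qed
    then have "(LINT x|lebesgue_on {a<..<b}. h x * \<psi> x) = (LINT x|lebesgue_on {a<..<b}. h' x * \<psi> x)"
      by simp
    then show "(LINT x|lebesgue_on {a<..<b}. (h x - h' x) * \<psi> x) = 0"
      using integrable_times_test_function[OF li(1) \<psi>] integrable_times_test_function[OF li(2) \<psi>]
      by (simp add: left_diff_distrib)
  qed
  then show ?thesis by simp
qed

text \<open>Makes the representative picked by \<open>SOME\<close> computable: any known weak
  derivative may stand for it almost everywhere.\<close>

lemma weak_deriv_AE_eq:
  assumes "is_weak_deriv a b j f h"
  shows "AE x in lebesgue_on {a<..<b}. weak_deriv a b j f x = h x"
  using weak_deriv_AE_unique[OF someI[of "is_weak_deriv a b j f", OF assms] assms]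
  by (simp add: weak_deriv_def)

lemma locally_integrable_AE_cong:
  assumes f: "locally_integrable a b f" and ae: "AE x in lebesgue_on {a<..<b}. f x = f' x"
  shows "locally_integrable a b f'"
  unfolding locally_integrable_def
proof (intro allI impI)
  fix c d assume cd: "a < c \<and> d < b"
  have "AE x in lebesgue. x \<in> {a<..<b} \<longrightarrow> f x = f' x" using ae by (simp add: AE_lebesgue_on)
  then obtain N where N: "N \<in> null_sets lebesgue" "{x. \<not> (x \<in> {a<..<b} \<longrightarrow> f x = f' x)} \<subseteq> N"
    by (auto simp: eventually_ae_filter)
  show "f' absolutely_integrable_on {c..d}"
  proof (rule absolutely_integrable_spike)
    show "f absolutely_integrable_on {c..d}" using f cd by (simp add: locally_integrable_def)
    show "negligible N" using N by (simp add: negligible_iff_null_sets)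
    fix x assume "x \<in> {c..d} - N"
    with cd have "x \<in> {a<..<b}" "x \<notin> N" by auto
    with N(2) show "f' x = f x" by auto
  qed
qed

text \<open>Needed for the nested derivative of \<rho> \<phi>', where the inner weak derivative is
  known only almost everywhere.\<close>

lemma is_weak_deriv_AE_cong:
  assumes wd: "is_weak_deriv a b j f h" and ae: "AE x in lebesgue_on {a<..<b}. f x = f' x"
  shows "is_weak_deriv a b j f' h"
  unfolding is_weak_deriv_def
proof (intro conjI allI impI)
  have f: "locally_integrable a b f" and "locally_integrable a b h"
    using wd by (auto simp: is_weak_deriv_def)
  then show f': "locally_integrable a b f'" and "locally_integrable a b h"
    using locally_integrable_AE_cong[OF _ ae] by auto
  fix \<psi> assume \<psi>: "test_function a b \<psi>"
  have "(LINT x|lebesgue_on {a<..<b}. f' x * (deriv ^^ j) \<psi> x)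
      = (LINT x|lebesgue_on {a<..<b}. f x * (deriv ^^ j) \<psi> x)"
  proof (rule integral_cong_AE)
    show "AE x in lebesgue_on {a<..<b}. f' x * (deriv ^^ j) \<psi> x = f x * (deriv ^^ j) \<psi> x"
      using ae by eventually_elim simp
  qed (rule borel_measurable_integrable integrable_times_test_function test_function_deriv_funpow f f' \<psi>)+
  also have "\<dots> = (-1) ^ j * (LINT x|lebesgue_on {a<..<b}. h x * \<psi> x)"
    using wd \<psi> by (simp add: is_weak_deriv_def)
  finally show "(LINT x|lebesgue_on {a<..<b}. f' x * (deriv ^^ j) \<psi> x)
      = (-1) ^ j * (LINT x|lebesgue_on {a<..<b}. h x * \<psi> x)" .
qed

text \<open>The induction hypothesis is applied to the test function \<open>deriv \<psi>\<close>;
  one integration by parts then raises the order, without boundary terms because \<psi> vanishes at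
  a and b.\<close>

lemma classical_imp_weak_deriv:
  fixes u :: "nat \<Rightarrow> real \<Rightarrow> real"
  assumes "a < b"
    and "\<And>i x. i < j \<Longrightarrow> x \<in> {a..b} \<Longrightarrow> (u i has_real_derivative u (Suc i) x) (at x within {a..b})"
    and "continuous_on {a..b} (u j)"
  shows "is_weak_deriv a b j (u 0) (u j)"
  using assms(2,3)
proof (induction j)
  case 0
  then show ?case
    by (simp add: is_weak_deriv_def continuous_locally_integrable)
next
  case (Suc j)
  have d: "(u j has_real_derivative u (Suc j) x) (at x within {a..b})" if "x \<in> {a..b}" for x
    using Suc.prems(1)[of j] that by simp
  have uj: "continuous_on {a..b} (u j)" by (rule continuous_on_by_deriv[OF d])
  have IH: "is_weak_deriv a b j (u 0) (u j)" by (rule Suc.IH) (use Suc.prems uj in auto)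
  show ?case
    unfolding is_weak_deriv_def
  proof (intro conjI allI impI)
    show "locally_integrable a b (u 0)" using IH by (simp add: is_weak_deriv_def)
    show "locally_integrable a b (u (Suc j))" by (rule continuous_locally_integrable[OF Suc.prems(2)])
    fix \<psi> assume \<psi>: "test_function a b \<psi>"
    note \<psi>' = test_function_deriv[OF \<psi>]
    obtain c e where ce: "a < c" "e < b" "\<And>x. x \<notin> {c..e} \<Longrightarrow> \<psi> x = 0"
      using test_function_support[OF \<psi>] by blast
    have 0: "\<psi> a = 0" "\<psi> b = 0" using ce by auto
    have "(LINT x|lebesgue_on {a<..<b}. u 0 x * (deriv ^^ Suc j) \<psi> x)
        = (-1) ^ j * (LINT x|lebesgue_on {a<..<b}. u j x * deriv \<psi> x)"
      using IH \<psi>' by (simp add: is_weak_deriv_def funpow_swap1)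
    also have "(LINT x|lebesgue_on {a<..<b}. u j x * deriv \<psi> x) = integral {a..b} (\<lambda>x. u j x * deriv \<psi> x)"
      by (intro LINT_Ioo continuous_intros uj test_function_continuous[OF \<psi>'])
    also have "\<dots> = - integral {a..b} (\<lambda>x. u (Suc j) x * \<psi> x)"
      using \<open>a < b\<close> 0
      by (subst integral_by_parts_Icc[OF _ d])
        (auto intro: has_field_derivative_at_within test_function_has_deriv[OF \<psi>] Suc.prems(2)
          test_function_continuous[OF \<psi>'])
    also have "integral {a..b} (\<lambda>x. u (Suc j) x * \<psi> x) = (LINT x|lebesgue_on {a<..<b}. u (Suc j) x * \<psi> x)"
      by (intro LINT_Ioo[symmetric] continuous_intros Suc.prems(2) test_function_continuous[OF \<psi>])
    finally show "(LINT x|lebesgue_on {a<..<b}. u 0 x * (deriv ^^ Suc j) \<psi> x)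
        = (-1) ^ Suc j * (LINT x|lebesgue_on {a<..<b}. u (Suc j) x * \<psi> x)" by simp
  qed
qed

section \<open>Normal modes\<close>

context rayleigh_taylor
begin

text \<open>Bundles the conditions on one pair so that the recursive choice of the sequence can
  carry them.\<close>

definition normal_mode :: "real \<Rightarrow> (real \<Rightarrow> real) \<Rightarrow> bool" where
  "normal_mode \<kappa> \<phi> \<longleftrightarrow> \<phi> \<in> sobolev_H 4 (-1) 1 \<and> nontrivial \<phi> \<and>
      (AE x in lebesgue_on {-1<..<1}.
         - \<kappa>\<^sup>2 * (\<rho> x * k\<^sup>2 * \<phi> x - wD 1 (\<lambda>y. \<rho> y * wD 1 \<phi> y) x) =
         \<kappa> * \<mu> * (wD 4 \<phi> x - 2 * k\<^sup>2 * wD 2 \<phi> x + k ^ 4 * \<phi> x)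
           - g * k\<^sup>2 * \<rho>' x * \<phi> x) \<and>
      val \<phi> (-1) = 0 \<and> val \<phi> 1 = 0 \<and>
      \<mu> * val (wD 2 \<phi>) 1 = \<xi>p * val (wD 1 \<phi>) 1 \<and>
      \<mu> * val (wD 2 \<phi>) (-1) = - \<xi>m * val (wD 1 \<phi>) (-1)"

lemma normal_mode_exists:
  assumes "\<epsilon> > 0"
  shows "\<exists>\<kappa> \<phi>. 0 < \<kappa> \<and> \<kappa> < \<epsilon> \<and> normal_mode \<kappa> \<phi>"
proof -
  obtain \<kappa> u0 u1 u2 u3 u4 where \<kappa>: "0 < \<kappa>" "\<kappa> < \<epsilon>" and c4: "continuous_on {-1..1} u4"
    and all: "\<forall>t\<in>{-1..1}. (u0 has_real_derivative u1 t) (at t within {-1..1}) \<and>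
      (u1 has_real_derivative u2 t) (at t within {-1..1}) \<and>
      (u2 has_real_derivative u3 t) (at t within {-1..1}) \<and>
      (u3 has_real_derivative u4 t) (at t within {-1..1}) \<and>
      - \<kappa>\<^sup>2 * (\<rho> t * k\<^sup>2 * u0 t - (\<rho>' t * u1 t + \<rho> t * u2 t)) =
        \<kappa> * \<mu> * (u4 t - 2 * k\<^sup>2 * u2 t + k^4 * u0 t) - g * k\<^sup>2 * \<rho>' t * u0 t"
    and bc: "u0 (-1) = 0" "u0 1 = 0" "\<mu> * u2 1 = \<xi>p * u1 1" "\<mu> * u2 (-1) = - \<xi>m * u1 (-1)"
    and nz: "\<exists>t\<in>{-1..1}. u0 t \<noteq> 0"
    using classical_solution[OF assms] by blast
  define u where "u i = [u0, u1, u2, u3, u4] ! i" for i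
  have du: "(u i has_real_derivative u (Suc i) x) (at x within {-1..1})" if "i < 4" "x \<in> {-1..1}" for i x
    using that all by (auto simp: u_def less_Suc_eq numeral_eq_Suc)
  have cu: "continuous_on {-1..1} (u i)" if "i \<le> 4" for i
  proof (cases "i = 4")
    case True then show ?thesis using c4 by (simp add: u_def)
  next
    case False
    then have "i < 4" using that by simp
    then show ?thesis by (intro continuous_on_by_deriv[OF du])
  qed
  have wd: "is_weak_deriv (-1) 1 j u0 (u j)" if "j \<le> 4" for j
  proof -
    have "is_weak_deriv (-1) 1 j (u 0) (u j)"
      by (rule classical_imp_weak_deriv) (use that du cu in auto)
    then show ?thesis by (simp add: u_def)
  qed
  have ae: "AE x in lebesgue_on {-1<..<1}. wD j u0 x = u j x" if "j \<le> 4" for j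
    by (rule weak_deriv_AE_eq[OF wd[OF that]])
  have val: "val (wD j u0) x = u j x" if "j \<le> 4" "x \<in> {-1..1}" for j x
    by (rule cont_value_eq[OF _ cu[OF that(1)] ae[OF that(1)] that(2)]) simp
  have val0: "val u0 x = u0 x" if "x \<in> {-1..1}" for x
    by (rule cont_value_eq[OF _ _ _ that]) (use cu[of 0] in \<open>auto simp: u_def\<close>)
  have [simp]: "u 0 = u0" "u (Suc 0) = u1" "u 2 = u2" "u 4 = u4"
    by (simp_all add: u_def)
  have ae': "AE x in lebesgue_on {-1<..<1}. wD 1 u0 x = u1 x" "AE x in lebesgue_on {-1<..<1}. wD 2 u0 x = u2 x"
    "AE x in lebesgue_on {-1<..<1}. wD 4 u0 x = u4 x"
    using ae[of 1] ae[of 2] ae[of 4] by simp_all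
  have sob: "u0 \<in> sobolev_H 4 (-1) 1"
    unfolding sobolev_H_def using continuous_L2[OF cu] wd cu[of 0] by (auto intro: continuous_L2)
  have cu0: "continuous_on {-1..1} u0" using cu[of 0] by simp
  have nt: "nontrivial u0"
    unfolding nontrivial_def
  proof
    assume "AE x in lebesgue_on {-1<..<1}. u0 x = 0"
    then have "u0 t = 0" if "t \<in> {-1..1}" for t
      by (intro continuous_AE_zero[OF _ cu0 _ that]) auto
    with nz show False by blast
  qed
  \<comment> \<open>The flux \<rho> u' and its classical derivative, from which the weak derivative
    of the flux is read off.\<close>
  define w where "w i = [\<lambda>x. \<rho> x * u1 x, \<lambda>x. \<rho>' x * u1 x + \<rho> x * u2 x] ! i" for i
  have w1: "continuous_on {-1..1} (w 1)"
    unfolding w_def using cu[of 1] cu[of 2] by (auto intro!: continuous_intros)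
  have "is_weak_deriv (-1) 1 1 (w 0) (w 1)"
    by (rule classical_imp_weak_deriv[where u = w and j = 1])
      (use all w1 in \<open>auto simp: w_def intro!: derivative_eq_intros \<rho>_deriv\<close>)
  then have "is_weak_deriv (-1) 1 1 (\<lambda>y. \<rho> y * wD 1 u0 y) (w 1)"
  proof (rule is_weak_deriv_AE_cong)
    show "AE x in lebesgue_on {-1<..<1}. w 0 x = \<rho> x * wD 1 u0 x"
      using ae'(1) by eventually_elim (simp add: w_def)
  qed
  from weak_deriv_AE_eq[OF this]
  have aew: "AE x in lebesgue_on {-1<..<1}. wD 1 (\<lambda>y. \<rho> y * wD 1 u0 y) x = \<rho>' x * u1 x + \<rho> x * u2 x"
    by (simp add: w_def)
  \<comment> \<open>The classical equation holds on [-1,1] only, so membership is carried along as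
    an almost-everywhere fact.\<close>
  have "AE x in lebesgue_on {-1<..<1}. x \<in> {-1<..<1::real}"
    by (simp add: AE_lebesgue_on)
  then have "AE x in lebesgue_on {-1<..<1}.
         - \<kappa>\<^sup>2 * (\<rho> x * k\<^sup>2 * u0 x - wD 1 (\<lambda>y. \<rho> y * wD 1 u0 y) x) =
         \<kappa> * \<mu> * (wD 4 u0 x - 2 * k\<^sup>2 * wD 2 u0 x + k ^ 4 * u0 x)
           - g * k\<^sup>2 * \<rho>' x * u0 x"
    using aew ae'(2,3)
  proof eventually_elim
    case (elim x)
    then have "x \<in> {-1..1}" by auto
    with all elim show ?case by auto
  qed
  with \<kappa> sob nt bc show ?thesis
    unfolding normal_mode_def
    by (intro exI[of _ \<kappa>] exI[of _ u0]) (simp add: val val0)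
qed

end

theorem theorem2p1:
  fixes L g \<mu> \<xi>m \<xi>p k \<rho>m \<rho>p :: real and \<rho>0 \<rho>0' :: "real \<Rightarrow> real"
  assumes "L > 0" and "g > 0" and "\<mu> > 0" and "\<xi>m \<ge> 0" and "\<xi>p \<ge> 0"
    and "\<exists>m::int. m \<noteq> 0 \<and> k = of_int m / L"
    and "\<And>x. x \<in> {-1..1} \<Longrightarrow> (\<rho>0 has_real_derivative \<rho>0' x) (at x within {-1..1})"
    and "continuous_on {-1..1} \<rho>0'"
    and "\<rho>0 (-1) = \<rho>m" and "\<rho>0 1 = \<rho>p" and "\<rho>m > 0" and "\<rho>p > 0"
    and "\<And>x. x \<in> {-1..1} \<Longrightarrow> \<rho>0' x > 0"
    and "\<mu> > mu_c k \<xi>m \<xi>p"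
  shows "\<exists>(\<Lambda> :: nat \<Rightarrow> real) (\<phi>s :: nat \<Rightarrow> real \<Rightarrow> real).
    (\<forall>n\<ge>1. \<Lambda> n > 0 \<and> \<Lambda> (Suc n) < \<Lambda> n) \<and> \<Lambda> \<longlonglongrightarrow> 0 \<and>
    (\<forall>n\<ge>1. \<phi>s n \<in> sobolev_H 4 (-1) 1 \<and> nontrivial (\<phi>s n) \<and>
      (AE x in lebesgue_on {-1<..<1}.
         - (\<Lambda> n)\<^sup>2 * (\<rho>0 x * k\<^sup>2 * \<phi>s n x - wD 1 (\<lambda>y. \<rho>0 y * wD 1 (\<phi>s n) y) x) =
         \<Lambda> n * \<mu> * (wD 4 (\<phi>s n) x - 2 * k\<^sup>2 * wD 2 (\<phi>s n) x + k ^ 4 * \<phi>s n x)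
           - g * k\<^sup>2 * \<rho>0' x * \<phi>s n x) \<and>
      val (\<phi>s n) (-1) = 0 \<and> val (\<phi>s n) 1 = 0 \<and>
      \<mu> * val (wD 2 (\<phi>s n)) 1 = \<xi>p * val (wD 1 (\<phi>s n)) 1 \<and>
      \<mu> * val (wD 2 (\<phi>s n)) (-1) = - \<xi>m * val (wD 1 (\<phi>s n)) (-1))"
proof -
  interpret rayleigh_taylor g \<mu> \<xi>m \<xi>p k \<rho>0 \<rho>0'
    by unfold_locales (use assms in auto)
  \<comment> \<open>Each new value is taken below both its predecessor and 1/(n + 1): the first
    gives strict decrease, the second the limit 0.\<close>
  have "\<exists>f :: nat \<Rightarrow> real \<times> (real \<Rightarrow> real). \<forall>n. (fst (f n) > 0 \<and> normal_mode (fst (f n)) (snd (f n))) \<and>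
      (fst (f (Suc n)) < fst (f n) \<and> fst (f (Suc n)) < inverse (real (Suc n)))"
  proof (rule dependent_nat_choice)
    show "\<exists>p. fst p > 0 \<and> normal_mode (fst p) (snd p)"
      using normal_mode_exists[of 1] by auto
    fix p :: "real \<times> (real \<Rightarrow> real)" and n
    assume "fst p > 0 \<and> normal_mode (fst p) (snd p)"
    then have "min (fst p) (inverse (real (Suc n))) > 0" by simp
    from normal_mode_exists[OF this]
    show "\<exists>q. (fst q > 0 \<and> normal_mode (fst q) (snd q)) \<and> (fst q < fst p \<and> fst q < inverse (real (Suc n)))"
      by auto
  qed
  then obtain f :: "nat \<Rightarrow> real \<times> (real \<Rightarrow> real)"
    where f: "\<And>n. fst (f n) > 0" "\<And>n. normal_mode (fst (f n)) (snd (f n))"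
      "\<And>n. fst (f (Suc n)) < fst (f n)" "\<And>n. fst (f (Suc n)) < inverse (real (Suc n))"
    by blast
  have "(\<lambda>n. fst (f (Suc n))) \<longlonglongrightarrow> 0"
    by (rule tendsto_sandwich[OF _ _ tendsto_const LIMSEQ_inverse_real_of_nat])
      (use f(1,4) in \<open>auto intro!: always_eventually less_imp_le\<close>)
  then have "(\<lambda>n. fst (f n)) \<longlonglongrightarrow> 0" by (rule LIMSEQ_imp_Suc)
  then show ?thesis
    using f(1-3) unfolding normal_mode_def
    by (intro exI[of _ "\<lambda>n. fst (f n)"] exI[of _ "\<lambda>n. snd (f n)"]) blast
qed

end
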